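(* Let $n\ge3$ and $m\ge2n$. Then $\overline{R\cdot\mathsf p}$ is not normal.
   Context: All varieties are over $\mathbb C$. Let $\mathfrak v$ be a complex vector space of dimension $m$ with basis $e_1,\dots,e_m$, $E=\operatorname{End}\mathfrak v$ (identified with $m\times m$ matrices $X=(x_{i,j})$), with basis of matrix units $e_{i,j}=e_i\otimes e_j^*$; $G=\operatorname{GL}(E)$, and $Q=S^m(E^* )$, the homogeneous polynomial functions of degree $m$ on $E$, with $G$ acting by $(g\cdot q)(X)=q(g^{-1}X)$. Define $\mathsf p\in Q$ by $\mathsf p(X)=x_{1,1}^{m-n}\operatorname{perm}(X^o)$, where $X^o=(x_{i,j})_{m-n+1\le i,j\le m}$ and $\operatorname{perm}$ is the permanent. Let $S\subset E$ be the span of $e_{1,1}$ and all $e_{i,j}$ with $m-n+1\le i,j\le m$, and $S^\perp$ the span of the remaining $e_{i,j}$. $L_P^2=\operatorname{GL}(S)$, viewed as a subgroup of $G$ acting as the identity on $S^\perp$; $R\subset L_P^2$ is the parabolic subgroup of elements stabilizing the line $\mathbb Ce_{1,1}$. $\overline{R\cdot\mathsf p}$ is the Zariski closure in $Q$ (reduced). *)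

theory Defs
  imports
    Complex_Main
    "HOL-Library.Function_Algebras"
    "HOL-Combinatorics.Permutations"
    "HOL-Algebra.Bij"
    "HOL-Algebra.Polynomials"
begin

subsection \<open>Integrally closed domains\<close>

definition frac_rel :: "('a, 'r) ring_scheme \<Rightarrow> (('a \<times> 'a) \<times> ('a \<times> 'a)) set" where
  "frac_rel A = {((a, b), (c, d)).
     a \<in> carrier A \<and> b \<in> carrier A - {\<zero>\<^bsub>A\<^esub>} \<and> c \<in> carrier A \<and> d \<in> carrier A - {\<zero>\<^bsub>A\<^esub>} \<and>
     a \<otimes>\<^bsub>A\<^esub> d = c \<otimes>\<^bsub>A\<^esub> b}"

definition fraction :: "('a, 'r) ring_scheme \<Rightarrow> 'a \<Rightarrow> 'a \<Rightarrow> ('a \<times> 'a) set" where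
  "fraction A a b = frac_rel A `` {(a, b)}"

definition fraction_field :: "('a, 'r) ring_scheme \<Rightarrow> ('a \<times> 'a) set ring" where
  "fraction_field A =
    \<lparr>carrier = (carrier A \<times> (carrier A - {\<zero>\<^bsub>A\<^esub>})) // frac_rel A,
     monoid.mult = (\<lambda>x y. \<Union>(a, b)\<in>x. \<Union>(c, d)\<in>y. fraction A (a \<otimes>\<^bsub>A\<^esub> c) (b \<otimes>\<^bsub>A\<^esub> d)),
     one = fraction A \<one>\<^bsub>A\<^esub> \<one>\<^bsub>A\<^esub>,
     zero = fraction A \<zero>\<^bsub>A\<^esub> \<one>\<^bsub>A\<^esub>,
     add = (\<lambda>x y. \<Union>(a, b)\<in>x. \<Union>(c, d)\<in>y.
              fraction A (a \<otimes>\<^bsub>A\<^esub> d \<oplus>\<^bsub>A\<^esub> c \<otimes>\<^bsub>A\<^esub> b) (b \<otimes>\<^bsub>A\<^esub> d))\<rparr>"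

text \<open>Polynomials in \<^theory>\<open>HOL-Algebra.Polynomials\<close> are coefficient lists with the leading
  coefficient first.\<close>

definition integral_over :: "('a, 'r) ring_scheme \<Rightarrow> 'a set \<Rightarrow> 'a \<Rightarrow> bool" where
  "integral_over K B x \<longleftrightarrow>
    (\<exists>p\<in>carrier (univ_poly K B). p \<noteq> [] \<and> hd p = \<one>\<^bsub>K\<^esub> \<and> ring.eval K p x = \<zero>\<^bsub>K\<^esub>)"

definition integrally_closed_domain :: "('a, 'r) ring_scheme \<Rightarrow> bool" where
  "integrally_closed_domain A \<longleftrightarrow>
    domain A \<and>
    (let B = (\<lambda>a. fraction A a \<one>\<^bsub>A\<^esub>) ` carrier A
     in \<forall>x\<in>carrier (fraction_field A). integral_over (fraction_field A) B x \<longrightarrow> x \<in> B)"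

subsection \<open>Closed subvarieties of complex vector spaces\<close>

text \<open>The vector spaces are finite-dimensional subspaces \<open>V\<close> of types \<open>'x \<Rightarrow> complex\<close>, with
  pointwise operations. A complex-valued function on such a \<open>V\<close> (or on a subset of it) is
  represented by its extension by zero, so that the functions on \<open>V\<close> form again such a space.\<close>

definition fscale :: "complex \<Rightarrow> ('x \<Rightarrow> complex) \<Rightarrow> 'x \<Rightarrow> complex" where
  "fscale c f = (\<lambda>x. c * f x)"

global_interpretation fun_space: vector_space fscale
  by standard (auto simp: fscale_def fun_eq_iff algebra_simps)

definition zero_ext :: "'x set \<Rightarrow> ('x \<Rightarrow> complex) \<Rightarrow> 'x \<Rightarrow> complex" where
  "zero_ext Z f = (\<lambda>x. if x \<in> Z then f x else 0)"

definition dual :: "('x \<Rightarrow> complex) set \<Rightarrow> (('x \<Rightarrow> complex) \<Rightarrow> complex) set" where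
  "dual V = {l. (\<forall>u\<in>V. \<forall>v\<in>V. l (u + v) = l u + l v) \<and> (\<forall>c. \<forall>v\<in>V. l (fscale c v) = c * l v) \<and>
     (\<forall>v. v \<notin> V \<longrightarrow> l v = 0)}"

definition dual_products :: "('x \<Rightarrow> complex) set \<Rightarrow> nat \<Rightarrow> (('x \<Rightarrow> complex) \<Rightarrow> complex) set" where
  "dual_products V d =
    {zero_ext V (\<lambda>v. \<Prod>i<d. l i v) | l :: nat \<Rightarrow> ('x \<Rightarrow> complex) \<Rightarrow> complex. \<forall>i<d. l i \<in> dual V}"

text \<open>\<open>sym_power_dual V d\<close> is $S^d(V^*)$ and \<open>poly_funs V\<close> is $S^\bullet(V^*)$, both as spaces of
  functions on \<open>V\<close>.\<close>

definition sym_power_dual :: "('x \<Rightarrow> complex) set \<Rightarrow> nat \<Rightarrow> (('x \<Rightarrow> complex) \<Rightarrow> complex) set" where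
  "sym_power_dual V d = fun_space.span (dual_products V d)"

definition poly_funs :: "('x \<Rightarrow> complex) set \<Rightarrow> (('x \<Rightarrow> complex) \<Rightarrow> complex) set" where
  "poly_funs V = fun_space.span (\<Union>d. dual_products V d)"

definition zariski_closure :: "('x \<Rightarrow> complex) set \<Rightarrow> ('x \<Rightarrow> complex) set \<Rightarrow> ('x \<Rightarrow> complex) set" where
  "zariski_closure V A = {v\<in>V. \<forall>f\<in>poly_funs V. (\<forall>a\<in>A. f a = 0) \<longrightarrow> f v = 0}"

definition coordinate_ring ::
  "('x \<Rightarrow> complex) set \<Rightarrow> ('x \<Rightarrow> complex) set \<Rightarrow> (('x \<Rightarrow> complex) \<Rightarrow> complex) ring" where
  "coordinate_ring V Z =
    \<lparr>carrier = zero_ext Z ` poly_funs V,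
     monoid.mult = (\<lambda>f g x. f x * g x),
     one = zero_ext Z (\<lambda>_. 1),
     zero = (\<lambda>_. 0),
     add = (\<lambda>f g x. f x + g x)\<rparr>"

text \<open>The variety \<open>Z\<close>, closed in \<open>V\<close>, carries its reduced structure. Its irreducibility is the
  clause \<open>domain\<close> in \<open>integrally_closed_domain\<close>.\<close>

definition normal_variety :: "('x \<Rightarrow> complex) set \<Rightarrow> ('x \<Rightarrow> complex) set \<Rightarrow> bool" where
  "normal_variety V Z \<longleftrightarrow> integrally_closed_domain (coordinate_ring V Z)"

definition GL :: "('x \<Rightarrow> complex) set \<Rightarrow> (('x \<Rightarrow> complex) \<Rightarrow> ('x \<Rightarrow> complex)) set" where
  "GL V = {g \<in> Bij V. (\<forall>u\<in>V. \<forall>v\<in>V. g (u + v) = g u + g v) \<and>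
     (\<forall>c. \<forall>v\<in>V. g (fscale c v) = fscale c (g v))}"

text \<open>The action of $\mathrm{GL}(V)$ on functions, $(g\cdot q)(v) = q(g^{-1}v)$.\<close>

definition act :: "('x \<Rightarrow> complex) set \<Rightarrow> (('x \<Rightarrow> complex) \<Rightarrow> ('x \<Rightarrow> complex)) \<Rightarrow>
    (('x \<Rightarrow> complex) \<Rightarrow> complex) \<Rightarrow> ('x \<Rightarrow> complex) \<Rightarrow> complex" where
  "act V g q = zero_ext V (\<lambda>v. q (inv_into V g v))"

subsection \<open>The padded permanent\<close>

text \<open>A matrix \<open>M\<close> of size \<open>m\<close> is a function on pairs of indices that vanishes outside
  \<open>{1..m} \<times> {1..m}\<close>.\<close>

type_synonym cmatrix = "nat \<times> nat \<Rightarrow> complex"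

definition E :: "nat \<Rightarrow> cmatrix set" where
  "E m = {M. \<forall>ij. ij \<notin> {1..m} \<times> {1..m} \<longrightarrow> M ij = 0}"

definition mat_unit :: "nat \<times> nat \<Rightarrow> cmatrix" where
  "mat_unit ij = (\<lambda>kl. if kl = ij then 1 else 0)"

definition Q :: "nat \<Rightarrow> (cmatrix \<Rightarrow> complex) set" where
  "Q m = sym_power_dual (E m) m"

text \<open>\<open>permanent I M\<close> is the permanent of the submatrix of \<open>M\<close> with rows and columns in \<open>I\<close>.\<close>

definition permanent :: "nat set \<Rightarrow> cmatrix \<Rightarrow> complex" where
  "permanent I M = (\<Sum>\<pi> | \<pi> permutes I. \<Prod>i\<in>I. M (i, \<pi> i))"

definition padded_perm :: "nat \<Rightarrow> nat \<Rightarrow> cmatrix \<Rightarrow> complex" where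
  "padded_perm m n = zero_ext (E m) (\<lambda>M. M (1, 1) ^ (m - n) * permanent {m - n + 1..m} M)"

definition S_indices :: "nat \<Rightarrow> nat \<Rightarrow> (nat \<times> nat) set" where
  "S_indices m n = insert (1, 1) ({m - n + 1..m} \<times> {m - n + 1..m})"

definition S :: "nat \<Rightarrow> nat \<Rightarrow> cmatrix set" where
  "S m n = fun_space.span (mat_unit ` S_indices m n)"

definition S_perp :: "nat \<Rightarrow> nat \<Rightarrow> cmatrix set" where
  "S_perp m n = fun_space.span (mat_unit ` ({1..m} \<times> {1..m} - S_indices m n))"

definition L2_P :: "nat \<Rightarrow> nat \<Rightarrow> (cmatrix \<Rightarrow> cmatrix) set" where
  "L2_P m n = {g \<in> GL (E m). g ` S m n = S m n \<and> (\<forall>M\<in>S_perp m n. g M = M)}"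

definition R :: "nat \<Rightarrow> nat \<Rightarrow> (cmatrix \<Rightarrow> cmatrix) set" where
  "R m n = {g \<in> L2_P m n. g ` fun_space.span {mat_unit (1, 1)} = fun_space.span {mat_unit (1, 1)}}"

definition R_orbit_closure :: "nat \<Rightarrow> nat \<Rightarrow> (cmatrix \<Rightarrow> complex) set" where
  "R_orbit_closure m n = zariski_closure (Q m) ((\<lambda>g. act (E m) g (padded_perm m n)) ` R m n)"

end

theory Submission
  imports Defs "HOL-Computational_Algebra.Polynomial"
begin

text \<open>Put \<open>d = m - n\<close>. Restricted to the span of the matrix units at \<open>(1, 1)\<close>, \<open>(m, m)\<close> and
  \<open>(m, m - 1)\<close>, a point of the orbit is \<open>(t * x + a1 * y + a2 * z) ^ d * f(y, z)\<close>. Write \<open>f_j\<close> for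
  the coefficient of \<open>y ^ (n - j) * z ^ j\<close> in \<open>f\<close>. The coefficients of this product, up to binomial
  factors, include \<open>u_j = t ^ d * f_j\<close> (\<open>j \<le> 2\<close>), \<open>v = t ^ (d - 1) * a1 * f_0\<close>,
  \<open>s = t ^ (d - 1) * (a1 * f_1 + a2 * f_0)\<close>, \<open>v' = t ^ (d - 2) * a1 ^ 2 * f_0\<close> and
  \<open>w = t ^ (d - 2) * (a1 ^ 2 * f_2 + 2 * a1 * a2 * f_1 + a2 ^ 2 * f_0)\<close>. The rational function
  \<open>h = v * u_1 / u_0 = t ^ (d - 1) * a1 * f_1\<close> satisfies \<open>h ^ 2 = s ^ 2 - w * u_0 + v' * u_2\<close>, so it is
  integral over the coordinate ring. It is not regular: it is homogeneous of degree one, hence a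
  regular \<open>h\<close> could be replaced by its linear part at the origin, a linear functional on \<open>Q\<close>. In first
  order around \<open>a1 = a2 = 0\<close> this functional would send \<open>d * x ^ (d - 1) * a * f\<close> to \<open>a1 * f_1\<close>. But
  the product of \<open>a\<close> and \<open>f\<close> is the same for \<open>a = y + z\<close>, \<open>f = y ^ n\<close> and for \<open>a = y\<close>,
  \<open>f = y ^ (n - 1) * (y + z)\<close>, where \<open>a1 * f_1\<close> is \<open>0\<close> and \<open>1\<close> respectively. Both \<open>f\<close> are products of
  linear forms, so these points lie in the orbit closure.\<close>

subsection \<open>Fraction fields\<close>

context domain
begin

lemma equiv_frac_rel: "equiv (carrier R \<times> (carrier R - {\<zero>})) (frac_rel R)"
proof (rule equivI)
  show "frac_rel R \<subseteq> (carrier R \<times> (carrier R - {\<zero>})) \<times> (carrier R \<times> (carrier R - {\<zero>}))"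
    by (auto simp: frac_rel_def)
  show "refl_on (carrier R \<times> (carrier R - {\<zero>})) (frac_rel R)"
    by (auto simp: refl_on_def frac_rel_def)
  show "sym (frac_rel R)"
    by (auto simp: sym_def frac_rel_def)
  show "trans (frac_rel R)"
  proof (rule transI)
    fix x y z assume xy: "(x, y) \<in> frac_rel R" and yz: "(y, z) \<in> frac_rel R"
    obtain a b c d e f where [simp]: "x = (a, b)" "y = (c, d)" "z = (e, f)"
      by (metis surj_pair)
    have mem: "a \<in> carrier R" "b \<in> carrier R" "c \<in> carrier R" "d \<in> carrier R" "e \<in> carrier R"
        "f \<in> carrier R" "b \<noteq> \<zero>" "d \<noteq> \<zero>" "f \<noteq> \<zero>"
      and eqs: "a \<otimes> d = c \<otimes> b" "c \<otimes> f = e \<otimes> d"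
      using xy yz by (auto simp: frac_rel_def)
    have "d \<otimes> (a \<otimes> f) = (a \<otimes> d) \<otimes> f" using mem by (simp add: m_ac)
    also have "\<dots> = (c \<otimes> f) \<otimes> b" using mem eqs by (simp add: m_ac)
    also have "\<dots> = d \<otimes> (e \<otimes> b)" using mem eqs by (simp add: m_ac)
    finally have "a \<otimes> f = e \<otimes> b" using mem by (simp add: m_lcancel)
    then show "(x, z) \<in> frac_rel R" using mem by (simp add: frac_rel_def)
  qed
qed

lemma fraction_eq_iff:
  assumes "a \<in> carrier R" "b \<in> carrier R - {\<zero>}" "c \<in> carrier R" "d \<in> carrier R - {\<zero>}"
  shows "fraction R a b = fraction R c d \<longleftrightarrow> a \<otimes> d = c \<otimes> b"
  unfolding fraction_def using eq_equiv_class_iff[OF equiv_frac_rel, of "(a, b)" "(c, d)"] assms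
  by (simp add: frac_rel_def)

lemma carrier_fraction_field:
  "carrier (fraction_field R) = {fraction R a b |a b. a \<in> carrier R \<and> b \<in> carrier R - {\<zero>}}"
  by (auto simp: fraction_field_def fraction_def quotient_def)

lemma fraction_closed:
  assumes "a \<in> carrier R" "b \<in> carrier R" "b \<noteq> \<zero>"
  shows "fraction R a b \<in> carrier (fraction_field R)"
  using assms by (auto simp: carrier_fraction_field)

lemma mult_closed_nonzero:
  assumes "a \<in> carrier R - {\<zero>}" "b \<in> carrier R - {\<zero>}"
  shows "a \<otimes> b \<in> carrier R - {\<zero>}"
  using assms integral by auto

text \<open>The unions over representatives in \<open>fraction_field\<close> collapse because the
  formula respects \<open>frac_rel\<close>; its symmetry reduces this to varying one of the two
  arguments.\<close>

lemma mult_fraction: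
  assumes "a \<in> carrier R" "b \<in> carrier R - {\<zero>}" "c \<in> carrier R" "d \<in> carrier R - {\<zero>}"
  shows "fraction R a b \<otimes>\<^bsub>fraction_field R\<^esub> fraction R c d = fraction R (a \<otimes> c) (b \<otimes> d)"
proof -
  have "(\<lambda>x y. case x of (a, b) \<Rightarrow> case y of (c, d) \<Rightarrow> fraction R (a \<otimes> c) (b \<otimes> d))
      respects2 frac_rel R"
  proof (rule congruent2_commuteI[OF equiv_frac_rel], goal_cases)
    case (1 y z) then show ?case by (auto simp: m_comm)
  next
    case (2 y z w)
    obtain p q p' q' r s where [simp]: "y = (p, q)" "z = (p', q')" "w = (r, s)" by (metis surj_pair)
    have mem: "p \<in> carrier R" "q \<in> carrier R - {\<zero>}" "p' \<in> carrier R" "q' \<in> carrier R - {\<zero>}"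
        "r \<in> carrier R" "s \<in> carrier R - {\<zero>}" and eq: "p \<otimes> q' = p' \<otimes> q"
      using 2 by (auto simp: frac_rel_def)
    have "(r \<otimes> p) \<otimes> (s \<otimes> q') = (r \<otimes> s) \<otimes> (p \<otimes> q')" using mem by (simp add: m_ac)
    also have "\<dots> = (r \<otimes> p') \<otimes> (s \<otimes> q)" using mem eq by (simp add: m_ac)
    finally show ?case using mem mult_closed_nonzero by (simp add: fraction_eq_iff)
  qed
  from UN_equiv_class2[OF equiv_frac_rel equiv_frac_rel this, of "(a, b)" "(c, d)"] show ?thesis
    using assms
    by (simp add: fraction_field_def fraction_def split_def)
qed

lemma add_fraction:
  assumes "a \<in> carrier R" "b \<in> carrier R - {\<zero>}" "c \<in> carrier R" "d \<in> carrier R - {\<zero>}"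
  shows "fraction R a b \<oplus>\<^bsub>fraction_field R\<^esub> fraction R c d = fraction R (a \<otimes> d \<oplus> c \<otimes> b) (b \<otimes> d)"
proof -
  have "(\<lambda>x y. case x of (a, b) \<Rightarrow> case y of (c, d) \<Rightarrow> fraction R (a \<otimes> d \<oplus> c \<otimes> b) (b \<otimes> d))
      respects2 frac_rel R"
  proof (rule congruent2_commuteI[OF equiv_frac_rel], goal_cases)
    case (1 y z) then show ?case by (auto simp: m_comm a_comm)
  next
    case (2 y z w)
    obtain p q p' q' r s where [simp]: "y = (p, q)" "z = (p', q')" "w = (r, s)" by (metis surj_pair)
    have mem: "p \<in> carrier R" "q \<in> carrier R - {\<zero>}" "p' \<in> carrier R" "q' \<in> carrier R - {\<zero>}"
        "r \<in> carrier R" "s \<in> carrier R - {\<zero>}" and eq: "p \<otimes> q' = p' \<otimes> q"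
      using 2 by (auto simp: frac_rel_def)
    have "(r \<otimes> q \<oplus> p \<otimes> s) \<otimes> (s \<otimes> q') = (r \<otimes> q) \<otimes> (s \<otimes> q') \<oplus> (s \<otimes> s) \<otimes> (p \<otimes> q')"
      using mem by (simp add: m_ac l_distr r_distr)
    also have "\<dots> = (r \<otimes> q' \<oplus> p' \<otimes> s) \<otimes> (s \<otimes> q)"
      using mem by (simp add: eq m_ac l_distr r_distr)
    finally show ?case using mem mult_closed_nonzero by (simp add: fraction_eq_iff)
  qed
  from UN_equiv_class2[OF equiv_frac_rel equiv_frac_rel this, of "(a, b)" "(c, d)"] show ?thesis
    using assms
    by (simp add: fraction_field_def fraction_def split_def)
qed

text \<open>Supplies the ring laws used when a polynomial is evaluated at a fraction in
  \<open>integrally_closed_sqrt\<close>.\<close>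

lemma cring_fraction_field: "cring (fraction_field R)" (is "cring ?K")
proof -
  have one: "\<one>\<^bsub>?K\<^esub> = fraction R \<one> \<one>" and zero: "\<zero>\<^bsub>?K\<^esub> = fraction R \<zero> \<one>"
    by (simp_all add: fraction_field_def)
  note K = carrier_fraction_field mult_fraction add_fraction one zero
  have nz: "\<And>a b. a \<in> carrier R \<Longrightarrow> b \<in> carrier R \<Longrightarrow> a \<otimes> b = \<zero> \<longleftrightarrow> a = \<zero> \<or> b = \<zero>"
    by (rule integral_iff)
  show ?thesis
  proof (rule cringI)
    show "abelian_group ?K"
    proof (rule abelian_groupI)
      fix x y assume "x \<in> carrier ?K" "y \<in> carrier ?K"
      then obtain a b c d where xy: "x = fraction R a b" "y = fraction R c d"
        and mem: "a \<in> carrier R" "b \<in> carrier R" "b \<noteq> \<zero>" "c \<in> carrier R" "d \<in> carrier R" "d \<noteq> \<zero>"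
        by (auto simp: carrier_fraction_field)
      then show "x \<oplus>\<^bsub>?K\<^esub> y \<in> carrier ?K"
        by (simp add: mult_fraction add_fraction nz fraction_closed)
      show "x \<oplus>\<^bsub>?K\<^esub> y = y \<oplus>\<^bsub>?K\<^esub> x"
        using mem by (simp add: xy K a_comm m_comm)
      fix z assume "z \<in> carrier ?K"
      then obtain e f where z: "z = fraction R e f" "e \<in> carrier R" "f \<in> carrier R" "f \<noteq> \<zero>"
        by (auto simp: carrier_fraction_field)
      show "x \<oplus>\<^bsub>?K\<^esub> y \<oplus>\<^bsub>?K\<^esub> z = x \<oplus>\<^bsub>?K\<^esub> (y \<oplus>\<^bsub>?K\<^esub> z)"
        using mem z by (simp add: xy K nz l_distr r_distr m_ac a_ac)
    next
      show "\<zero>\<^bsub>?K\<^esub> \<in> carrier ?K" by (simp add: zero fraction_closed)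
    next
      fix x assume "x \<in> carrier ?K"
      then obtain a b where x: "x = fraction R a b" "a \<in> carrier R" "b \<in> carrier R" "b \<noteq> \<zero>"
        by (auto simp: carrier_fraction_field)
      then show "\<zero>\<^bsub>?K\<^esub> \<oplus>\<^bsub>?K\<^esub> x = x" by (simp add: K)
      have "fraction R (\<ominus> a) b \<oplus>\<^bsub>?K\<^esub> x = \<zero>\<^bsub>?K\<^esub>"
        using x by (simp add: K fraction_eq_iff nz l_minus l_neg)
      moreover have "fraction R (\<ominus> a) b \<in> carrier ?K" using x by (auto simp: K)
      ultimately show "\<exists>y\<in>carrier ?K. y \<oplus>\<^bsub>?K\<^esub> x = \<zero>\<^bsub>?K\<^esub>" by blast
    qed
    show "Group.comm_monoid ?K"
    proof (rule comm_monoidI)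
      fix x y assume "x \<in> carrier ?K" "y \<in> carrier ?K"
      then obtain a b c d where xy: "x = fraction R a b" "y = fraction R c d"
        and mem: "a \<in> carrier R" "b \<in> carrier R" "b \<noteq> \<zero>" "c \<in> carrier R" "d \<in> carrier R" "d \<noteq> \<zero>"
        by (auto simp: carrier_fraction_field)
      then show "x \<otimes>\<^bsub>?K\<^esub> y \<in> carrier ?K"
        by (simp add: mult_fraction nz fraction_closed)
      show "x \<otimes>\<^bsub>?K\<^esub> y = y \<otimes>\<^bsub>?K\<^esub> x"
        using mem by (simp add: xy K m_comm)
      fix z assume "z \<in> carrier ?K"
      then obtain e f where z: "z = fraction R e f" "e \<in> carrier R" "f \<in> carrier R" "f \<noteq> \<zero>"
        by (auto simp: carrier_fraction_field)
      show "x \<otimes>\<^bsub>?K\<^esub> y \<otimes>\<^bsub>?K\<^esub> z = x \<otimes>\<^bsub>?K\<^esub> (y \<otimes>\<^bsub>?K\<^esub> z)"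
        using mem z by (simp add: xy K nz m_ac)
    next
      show "\<one>\<^bsub>?K\<^esub> \<in> carrier ?K" by (simp add: one fraction_closed)
    next
      fix x assume "x \<in> carrier ?K"
      then obtain a b where x: "x = fraction R a b" "a \<in> carrier R" "b \<in> carrier R" "b \<noteq> \<zero>"
        by (auto simp: carrier_fraction_field)
      then show "\<one>\<^bsub>?K\<^esub> \<otimes>\<^bsub>?K\<^esub> x = x" by (simp add: K)
    qed
    fix x y z assume "x \<in> carrier ?K" "y \<in> carrier ?K" "z \<in> carrier ?K"
    then obtain a b c d e f where xyz: "x = fraction R a b" "y = fraction R c d" "z = fraction R e f"
      and mem: "a \<in> carrier R" "b \<in> carrier R" "b \<noteq> \<zero>" "c \<in> carrier R" "d \<in> carrier R" "d \<noteq> \<zero>"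
        "e \<in> carrier R" "f \<in> carrier R" "f \<noteq> \<zero>"
      by (auto simp: carrier_fraction_field)
    show "(x \<oplus>\<^bsub>?K\<^esub> y) \<otimes>\<^bsub>?K\<^esub> z = x \<otimes>\<^bsub>?K\<^esub> z \<oplus>\<^bsub>?K\<^esub> y \<otimes>\<^bsub>?K\<^esub> z"
      using mem by (simp add: xyz K nz fraction_eq_iff l_distr r_distr m_ac)
  qed
qed

text \<open>The fraction \<open>a / b\<close> is a root of the monic polynomial
  \<open>X ^ 2 - c\<close>, so it is integral and lies in the ring. This is the form in which
  normality enters \<open>not_normal\<close>.\<close>

lemma integrally_closed_sqrt:
  assumes closed: "integrally_closed_domain R"
    and mem: "a \<in> carrier R" "b \<in> carrier R - {\<zero>}" "c \<in> carrier R"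
    and eq: "a \<otimes> a = c \<otimes> (b \<otimes> b)"
  shows "\<exists>r\<in>carrier R. a = r \<otimes> b"
proof -
  define K where "K = fraction_field R"
  define B where "B = (\<lambda>a. fraction R a \<one>) ` carrier R"
  interpret K: cring K unfolding K_def by (rule cring_fraction_field)
  have one: "\<one>\<^bsub>K\<^esub> = fraction R \<one> \<one>" and zero: "\<zero>\<^bsub>K\<^esub> = fraction R \<zero> \<one>"
    by (simp_all add: K_def fraction_field_def)
  let ?x = "fraction R a b"
  have xK: "?x \<in> carrier K" using mem by (auto simp: K_def carrier_fraction_field)
  have BK: "B \<subseteq> carrier K" by (auto simp: B_def K_def fraction_closed)
  let ?p = "[\<one>\<^bsub>K\<^esub>, \<zero>\<^bsub>K\<^esub>, fraction R (\<ominus> c) \<one>]"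
  have cB: "fraction R (\<ominus> c) \<one> \<in> B" using mem by (auto simp: B_def)
  \<comment> \<open>\<open>polynomial_def\<close> demands a nonzero leading coefficient in the list
    \<open>?p\<close>.\<close>
  have "\<one>\<^bsub>K\<^esub> \<noteq> \<zero>\<^bsub>K\<^esub>"
    unfolding one zero by (subst fraction_eq_iff) auto
  moreover have "\<one>\<^bsub>K\<^esub> \<in> B" "\<zero>\<^bsub>K\<^esub> \<in> B" unfolding one zero B_def by auto
  ultimately have p: "?p \<in> carrier (univ_poly K B)"
    using cB by (simp add: univ_poly_carrier[symmetric] polynomial_def)
  have xx: "?x \<otimes>\<^bsub>K\<^esub> ?x = fraction R c \<one>"
    unfolding K_def using mem eq mult_closed_nonzero[OF mem(2,2)]
    by (simp add: mult_fraction fraction_eq_iff)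
  have "fraction R c \<one> \<oplus>\<^bsub>K\<^esub> fraction R (\<ominus> c) \<one> = \<zero>\<^bsub>K\<^esub>"
    unfolding zero unfolding K_def using mem by (simp add: add_fraction r_neg)
  moreover have "fraction R (\<ominus> c) \<one> \<in> carrier K" using cB BK by blast
  ultimately have "K.eval ?p ?x = \<zero>\<^bsub>K\<^esub>"
    using xK by (simp add: numeral_2_eq_2 xx[symmetric])
  then have "integral_over K B ?x"
    unfolding integral_over_def using p by (intro bexI[of _ ?p]) auto
  then have "?x \<in> B"
    using closed xK unfolding integrally_closed_domain_def Let_def K_def B_def by blast
  then obtain r where "r \<in> carrier R" "?x = fraction R r \<one>" unfolding B_def by blast
  then show ?thesis using mem by (auto simp: fraction_eq_iff)
qed

end

subsection \<open>Polynomial functions along smooth curves\<close>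

lemma dual_add: "l \<in> dual V \<Longrightarrow> u \<in> V \<Longrightarrow> v \<in> V \<Longrightarrow> l (u + v) = l u + l v"
  and dual_scale: "l \<in> dual V \<Longrightarrow> v \<in> V \<Longrightarrow> l (fscale c v) = c * l v"
  and dual_outside: "l \<in> dual V \<Longrightarrow> v \<notin> V \<Longrightarrow> l v = 0"
  by (auto simp: dual_def)

lemma dual_zero: "l \<in> dual V \<Longrightarrow> 0 \<in> V \<Longrightarrow> l 0 = 0"
  using dual_scale[of l V 0 0] by simp

lemma dual_zero_ext:
  assumes "fun_space.subspace V"
    and "\<And>u v. u \<in> V \<Longrightarrow> v \<in> V \<Longrightarrow> f (u + v) = f u + f v"
    and "\<And>c v. v \<in> V \<Longrightarrow> f (fscale c v) = c * f v"
  shows "zero_ext V f \<in> dual V"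
  using assms by (auto simp: dual_def zero_ext_def fun_space.subspace_def)

lemma zero_in_dual: "(\<lambda>_. 0) \<in> dual V"
  by (simp add: dual_def)

lemma add_in_dual: "k \<in> dual V \<Longrightarrow> l \<in> dual V \<Longrightarrow> (\<lambda>v. k v + l v) \<in> dual V"
  by (simp add: dual_def algebra_simps)

lemma scale_in_dual: "l \<in> dual V \<Longrightarrow> (\<lambda>v. c * l v) \<in> dual V"
  by (simp add: dual_def algebra_simps)

lemma dual_subset_poly_funs: "dual V \<subseteq> poly_funs V"
proof
  fix l assume l: "l \<in> dual V"
  then have "l = zero_ext V (\<lambda>v. \<Prod>i<(1::nat). l v)"
    by (auto simp: zero_ext_def dual_outside fun_eq_iff)
  then have "l \<in> dual_products V 1"
    unfolding dual_products_def using l by (intro CollectI exI[of _ "\<lambda>_. l"]) auto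
  then show "l \<in> poly_funs V"
    unfolding poly_funs_def by (intro fun_space.span_base) auto
qed

lemma subspace_sym_power_dual: "fun_space.subspace (sym_power_dual V d)"
  by (simp add: sym_power_dual_def)

lemma sym_power_dual_mult:
  assumes "w \<in> sym_power_dual V k" and l: "l \<in> dual V"
  shows "w * l \<in> sym_power_dual V (Suc k)"
  using assms(1) unfolding sym_power_dual_def
proof (induction rule: fun_space.span_induct_alt)
  case base show ?case
    using fun_space.span_zero by (simp add: zero_fun_def times_fun_def)
next
  case (step c x y)
  then obtain p where p: "x = zero_ext V (\<lambda>v. \<Prod>i<k. p i v)" "\<forall>i<k. p i \<in> dual V"
    by (auto simp: dual_products_def)
  have "x * l = zero_ext V (\<lambda>v. \<Prod>i<Suc k. (p(k := l)) i v)"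
    using l by (auto simp: p zero_ext_def fun_eq_iff dual_outside)
  then have xl: "x * l \<in> dual_products V (Suc k)"
    unfolding dual_products_def using l p(2)
    by (intro CollectI exI[of _ "p(k := l)"]) auto
  then have "fscale c (x * l) + y * l \<in> fun_space.span (dual_products V (Suc k))"
    using fun_space.span_add[OF fun_space.span_scale[OF fun_space.span_base[OF xl]]] step by blast
  moreover have "(fscale c x + y) * l = fscale c (x * l) + y * l"
    by (auto simp: fun_eq_iff fscale_def algebra_simps)
  ultimately show ?case by argo
qed

text \<open>Complex differentiability is tested through linear functionals, so \<open>W\<close>
  carries no topology. A single vector \<open>w\<close> has to serve as the derivative for all
  functionals at once.\<close>

definition smooth_curve :: "('x \<Rightarrow> complex) set \<Rightarrow> (complex \<Rightarrow> 'x \<Rightarrow> complex) \<Rightarrow> bool" where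
  "smooth_curve W \<gamma> \<longleftrightarrow> (\<forall>e. \<gamma> e \<in> W) \<and>
     (\<forall>e. \<exists>w\<in>W. \<forall>l\<in>dual W. ((\<lambda>e. l (\<gamma> e)) has_field_derivative l w) (at e))"

lemma smooth_curveD: "smooth_curve W \<gamma> \<Longrightarrow> \<gamma> e \<in> W"
  by (simp add: smooth_curve_def)

lemma smooth_curve_deriv:
  assumes "smooth_curve W \<gamma>"
  obtains w where "w \<in> W"
    and "\<And>l. l \<in> dual W \<Longrightarrow> ((\<lambda>e. l (\<gamma> e)) has_field_derivative l w) (at e)"
  using assms unfolding smooth_curve_def by metis

lemma smooth_curve_const:
  assumes "fun_space.subspace W" "w \<in> W"
  shows "smooth_curve W (\<lambda>_. w)"
  unfolding smooth_curve_def
proof (intro conjI allI bexI[of _ 0] ballI)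
  show "0 \<in> W" using assms fun_space.subspace_0 by blast
  then show "((\<lambda>e. l w) has_field_derivative l 0) (at e)" if "l \<in> dual W" for l e
    using that by (simp add: dual_zero)
qed (use assms in auto)

lemma smooth_curve_add:
  assumes W: "fun_space.subspace W" and "smooth_curve W \<gamma>" "smooth_curve W \<delta>"
  shows "smooth_curve W (\<lambda>e. \<gamma> e + \<delta> e)"
  unfolding smooth_curve_def
proof (intro conjI allI)
  note mem = smooth_curveD[OF assms(2)] smooth_curveD[OF assms(3)]
  show "\<gamma> e + \<delta> e \<in> W" for e
    using W mem by (simp add: fun_space.subspace_add)
  fix e
  obtain u where u: "u \<in> W"
    and du: "\<And>l. l \<in> dual W \<Longrightarrow> ((\<lambda>e. l (\<gamma> e)) has_field_derivative l u) (at e)"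
    using smooth_curve_deriv[OF assms(2), of e] by blast
  obtain w where w: "w \<in> W"
    and dw: "\<And>l. l \<in> dual W \<Longrightarrow> ((\<lambda>e. l (\<delta> e)) has_field_derivative l w) (at e)"
    using smooth_curve_deriv[OF assms(3), of e] by blast
  show "\<exists>w\<in>W. \<forall>l\<in>dual W. ((\<lambda>e. l (\<gamma> e + \<delta> e)) has_field_derivative l w) (at e)"
  proof (intro bexI[of _ "u + w"] ballI)
    fix l assume l: "l \<in> dual W"
    show "((\<lambda>e. l (\<gamma> e + \<delta> e)) has_field_derivative l (u + w)) (at e)"
      using DERIV_add[OF du[OF l] dw[OF l]] l mem u w by (simp add: dual_add)
  qed (use W u w in \<open>simp add: fun_space.subspace_add\<close>)
qed

lemma smooth_curve_sum:
  assumes "fun_space.subspace W" "finite J" "\<And>j. j \<in> J \<Longrightarrow> smooth_curve W (\<gamma> j)"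
  shows "smooth_curve W (\<lambda>e. \<Sum>j\<in>J. \<gamma> j e)"
  using assms(2,3)
proof (induction J rule: finite_induct)
  case empty
  then show ?case
    using smooth_curve_const[OF assms(1) fun_space.subspace_0[OF assms(1)]] by (simp add: zero_fun_def)
next
  case (insert j J)
  then have "smooth_curve W (\<lambda>e. \<gamma> j e + (\<Sum>j\<in>J. \<gamma> j e))"
    by (intro smooth_curve_add[OF assms(1)]) auto
  then show ?case unfolding sum.insert[OF insert.hyps(1,2)] .
qed

text \<open>A functional on degree \<open>Suc k\<close> pulls back along multiplication by
  \<open>l0\<close> or \<open>l1\<close> to a functional on degree \<open>k\<close>, where the
  differentiability of \<open>\<gamma>\<close> applies.\<close>

lemma smooth_curve_mult_affine:
  assumes \<gamma>: "smooth_curve (sym_power_dual V k) \<gamma>" and l: "l0 \<in> dual V" "l1 \<in> dual V"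
  shows "smooth_curve (sym_power_dual V (Suc k)) (\<lambda>e. \<gamma> e * (\<lambda>v. l0 v + e * l1 v))"
    (is "smooth_curve ?W' _")
proof -
  let ?W = "sym_power_dual V k"
  have sub: "fun_space.subspace ?W" "fun_space.subspace ?W'" by (rule subspace_sym_power_dual)+
  have mem: "\<gamma> e \<in> ?W" for e using \<gamma> by (rule smooth_curveD)
  have mult: "w * l0 \<in> ?W'" "w * l1 \<in> ?W'" if "w \<in> ?W" for w
    using sym_power_dual_mult that l by blast+
  have split: "\<gamma> e * (\<lambda>v. l0 v + e * l1 v) = \<gamma> e * l0 + fscale e (\<gamma> e * l1)" for e
    by (auto simp: fun_eq_iff fscale_def algebra_simps)
  have pull: "zero_ext ?W (\<lambda>w. L (w * l)) \<in> dual ?W" if "L \<in> dual ?W'" "l \<in> {l0, l1}" for L l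
  proof (rule dual_zero_ext[OF sub(1)])
    fix u v c assume u: "u \<in> ?W"
    have "fscale c u * l = fscale c (u * l)" by (auto simp: fun_eq_iff fscale_def)
    then show "L (fscale c u * l) = c * L (u * l)"
      using that u mult by (auto simp: dual_scale)
    assume v: "v \<in> ?W"
    show "L ((u + v) * l) = L (u * l) + L (v * l)"
      using that u v mult by (auto simp: distrib_right dual_add)
  qed
  show ?thesis
    unfolding smooth_curve_def split
  proof (intro conjI allI)
    show "\<gamma> e * l0 + fscale e (\<gamma> e * l1) \<in> ?W'" for e
      using mem mult sub by (simp add: fun_space.subspace_add fun_space.subspace_scale)
    fix e
    obtain u where u: "u \<in> ?W"
      and d: "\<And>L. L \<in> dual ?W \<Longrightarrow> ((\<lambda>e. L (\<gamma> e)) has_field_derivative L u) (at e)"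
      using smooth_curve_deriv[OF \<gamma>, of e] by blast
    \<comment> \<open>The derivative given by the product rule, with \<open>u\<close> the derivative
      of \<open>\<gamma>\<close> at \<open>e\<close>.\<close>
    let ?c = "u * l0 + (fscale e (u * l1) + \<gamma> e * l1)"
    show "\<exists>w\<in>?W'. \<forall>L\<in>dual ?W'.
        ((\<lambda>e. L (\<gamma> e * l0 + fscale e (\<gamma> e * l1))) has_field_derivative L w) (at e)"
    proof (intro bexI[of _ ?c] ballI)
      show "?c \<in> ?W'"
        using mem mult sub u by (simp add: fun_space.subspace_add fun_space.subspace_scale)
      fix L assume L: "L \<in> dual ?W'"
      have d0: "((\<lambda>e. L (\<gamma> e * l0)) has_field_derivative L (u * l0)) (at e)"
       and d1: "((\<lambda>e. L (\<gamma> e * l1)) has_field_derivative L (u * l1)) (at e)"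
        using d[OF pull[OF L], of l0] d[OF pull[OF L], of l1] mem u by (simp_all add: zero_ext_def)
      have "((\<lambda>e. L (\<gamma> e * l0) + e * L (\<gamma> e * l1)) has_field_derivative
          L (u * l0) + (e * L (u * l1) + L (\<gamma> e * l1))) (at e)"
        using DERIV_add[OF d0 DERIV_mult[OF DERIV_ident d1]] by (simp add: algebra_simps)
      moreover have "L (\<gamma> e * l0 + fscale e (\<gamma> e * l1)) = L (\<gamma> e * l0) + e * L (\<gamma> e * l1)" for e
        using L mem mult sub by (simp add: dual_add dual_scale fun_space.subspace_scale)
      moreover have "L ?c = L (u * l0) + (e * L (u * l1) + L (\<gamma> e * l1))"
        using L mem mult sub u
        by (simp add: dual_add dual_scale fun_space.subspace_scale fun_space.subspace_add)
      ultimately show "((\<lambda>e. L (\<gamma> e * l0 + fscale e (\<gamma> e * l1))) has_field_derivative L ?c) (at e)"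
        by simp
    qed
  qed
qed

lemma smooth_curve_mult_prod_affine:
  assumes "finite J" and "smooth_curve (sym_power_dual V k) \<gamma>"
    and "\<And>j. j \<in> J \<Longrightarrow> l0 j \<in> dual V" "\<And>j. j \<in> J \<Longrightarrow> l1 j \<in> dual V"
  shows "smooth_curve (sym_power_dual V (k + card J)) (\<lambda>e. \<gamma> e * (\<lambda>v. \<Prod>j\<in>J. l0 j v + e * l1 j v))"
  using assms(1,3,4)
proof (induction J rule: finite_induct)
  case empty
  have "\<gamma> e * (\<lambda>v. \<Prod>j\<in>{}. l0 j v + e * l1 j v) = \<gamma> e" for e by (simp add: fun_eq_iff)
  then show ?case using assms(2) by simp
next
  case (insert j J)
  have "smooth_curve (sym_power_dual V (Suc (k + card J)))
      (\<lambda>e. (\<gamma> e * (\<lambda>v. \<Prod>j\<in>J. l0 j v + e * l1 j v)) * (\<lambda>v. l0 j v + e * l1 j v))"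
    by (rule smooth_curve_mult_affine[OF insert.IH]) (auto intro: insert.prems)
  moreover have "(\<gamma> e * (\<lambda>v. \<Prod>j\<in>J. l0 j v + e * l1 j v)) * (\<lambda>v. l0 j v + e * l1 j v)
      = \<gamma> e * (\<lambda>v. \<Prod>j\<in>insert j J. l0 j v + e * l1 j v)" for e
    using insert.hyps by (simp add: fun_eq_iff algebra_simps)
  ultimately show ?case using insert.hyps by (simp del: times_fun_apply)
qed

text \<open>A polynomial function is a combination of products of functionals, each continuous along
  the curve. This carries vanishing from nearby points of a curve to a limit point.\<close>

lemma isCont_poly_fun_smooth_curve:
  assumes \<gamma>: "smooth_curve W \<gamma>" and "F \<in> poly_funs W"
  shows "isCont (\<lambda>e. F (\<gamma> e)) a"
  using assms(2) unfolding poly_funs_def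
proof (induction rule: fun_space.span_induct_alt)
  case base show ?case by simp
next
  case (step c x y)
  then obtain d where "x \<in> dual_products W d" by blast
  then obtain p where p: "x = zero_ext W (\<lambda>v. \<Prod>i<d. p i v)" "\<forall>i<d. p i \<in> dual W"
    unfolding dual_products_def by blast
  have "isCont (\<lambda>e. p i (\<gamma> e)) a" if "i < d" for i
    using smooth_curve_deriv[OF \<gamma>] p(2) that by (metis DERIV_isCont)
  then have "isCont (\<lambda>e. \<Prod>i<d. p i (\<gamma> e)) a" by (intro continuous_intros) auto
  then have "isCont (\<lambda>e. x (\<gamma> e)) a"
    using smooth_curveD[OF \<gamma>] by (simp add: p zero_ext_def)
  then show ?case using step by (auto simp: fscale_def intro!: continuous_intros)
qed

text \<open>Here \<open>l\<close> is the homogeneous part of degree one of \<open>F\<close>: on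
  \<open>fscale c w\<close> a product of \<open>d\<close> functionals scales by
  \<open>c ^ d\<close>, so only \<open>d = 1\<close> contributes to the derivative at 0.\<close>

lemma poly_fun_linear_part:
  assumes W: "fun_space.subspace W" and "F \<in> poly_funs W"
  shows "\<exists>l\<in>dual W. \<forall>w\<in>W. ((\<lambda>c. F (fscale c w)) has_field_derivative l w) (at 0)"
  using assms(2) unfolding poly_funs_def
proof (induction rule: fun_space.span_induct_alt)
  case base show ?case by (intro bexI[of _ "\<lambda>_. 0"]) (auto simp: zero_in_dual)
next
  case (step c x y)
  then obtain d where "x \<in> dual_products W d" by blast
  then obtain p where p: "x = zero_ext W (\<lambda>v. \<Prod>i<d. p i v)" "\<forall>i<d. p i \<in> dual W"
    unfolding dual_products_def by blast
  let ?k = "if d = 1 then p 0 else (\<lambda>_. 0)"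
  have k: "?k \<in> dual W" using p(2) by (simp add: zero_in_dual)
  have x: "x (fscale b w) = b ^ d * (\<Prod>i<d. p i w)" if "w \<in> W" for b w
  proof -
    have "(\<Prod>i<d. p i (fscale b w)) = (\<Prod>i<d. b * p i w)"
      using p(2) that by (intro prod.cong) (auto simp: dual_scale)
    then show ?thesis
      using that p W by (simp add: zero_ext_def fun_space.subspace_scale prod.distrib)
  qed
  have dx: "((\<lambda>b. x (fscale b w)) has_field_derivative ?k w) (at 0)" if w: "w \<in> W" for w
  proof -
    have "((\<lambda>b. b ^ d * (\<Prod>i<d. p i w)) has_field_derivative
        of_nat d * 0 ^ (d - 1) * (\<Prod>i<d. p i w)) (at 0)"
      by (auto intro!: derivative_eq_intros)
    \<comment> \<open>For \<open>d = 0\<close> the truncated exponent gives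
      \<open>0 ^ 0 = 1\<close>, but then the factor \<open>of_nat d\<close> is 0.\<close>
    moreover have "of_nat d * 0 ^ (d - 1) * (\<Prod>i<d. p i w) = ?k w"
      by (cases "d = 0"; cases "d = 1") (auto simp: power_0_left)
    ultimately show ?thesis by (simp add: x w)
  qed
  obtain l where l: "l \<in> dual W"
      and dy: "\<And>w. w \<in> W \<Longrightarrow> ((\<lambda>b. y (fscale b w)) has_field_derivative l w) (at 0)"
    using step by blast
  show ?case
  proof (intro bexI[of _ "\<lambda>w. c * ?k w + l w"] ballI)
    show "(\<lambda>w. c * ?k w + l w) \<in> dual W" using k l by (intro add_in_dual scale_in_dual)
    show "((\<lambda>b. (fscale c x + y) (fscale b w)) has_field_derivative c * ?k w + l w) (at 0)"
      if "w \<in> W" for w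
      using DERIV_add[OF DERIV_cmult[OF dx[OF that], of c] dy[OF that]] by (simp add: fscale_def)
  qed
qed

subsection \<open>Coefficient functionals and the padded permanent\<close>

lemma subspace_vanishing: "fun_space.subspace {M. \<forall>ij. ij \<notin> J \<longrightarrow> M ij = 0}"
  by (auto simp: fun_space.subspace_def fscale_def)

text \<open>Turns \<open>S\<close>, \<open>S_perp\<close> and the line of
  \<open>mat_unit (1, 1)\<close> into conditions on supports, against which shears are easily
  checked.\<close>

lemma span_mat_unit:
  assumes "finite J"
  shows "fun_space.span (mat_unit ` J) = {M. \<forall>ij. ij \<notin> J \<longrightarrow> M ij = 0}"
proof
  show "fun_space.span (mat_unit ` J) \<subseteq> {M. \<forall>ij. ij \<notin> J \<longrightarrow> M ij = 0}"
    by (rule fun_space.span_minimal[OF _ subspace_vanishing]) (auto simp: mat_unit_def)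
  show "{M. \<forall>ij. ij \<notin> J \<longrightarrow> M ij = 0} \<subseteq> fun_space.span (mat_unit ` J)"
  proof
    fix M :: cmatrix assume M: "M \<in> {M. \<forall>ij. ij \<notin> J \<longrightarrow> M ij = 0}"
    have sum_apply: "(\<Sum>ij\<in>A. f ij) kl = (\<Sum>ij\<in>A. f ij kl)" if "finite A"
      for A and f :: "nat \<times> nat \<Rightarrow> cmatrix" and kl
      using that by (induction A rule: finite_induct) auto
    have "(\<Sum>ij\<in>J. fscale (M ij) (mat_unit ij)) kl = M kl" for kl
    proof -
      have "(\<Sum>ij\<in>J. fscale (M ij) (mat_unit ij)) kl = (\<Sum>ij\<in>J. if kl = ij then M ij else 0)"
        unfolding sum_apply[OF assms] by (intro sum.cong) (auto simp: fscale_def mat_unit_def)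
      also have "\<dots> = M kl" using assms M by (cases kl) auto
      finally show ?thesis .
    qed
    then have "M = (\<Sum>ij\<in>J. fscale (M ij) (mat_unit ij))" by auto
    also have "\<dots> \<in> fun_space.span (mat_unit ` J)"
      by (intro fun_space.span_sum fun_space.span_scale fun_space.span_base) auto
    finally show "M \<in> fun_space.span (mat_unit ` J)" .
  qed
qed

lemma subspace_E: "fun_space.subspace (E m)"
  unfolding E_def by (rule subspace_vanishing)

text \<open>Each permutation contributes a product of \<open>(m - n) + n = m\<close> linear forms
  whose coefficients are affine in \<open>e\<close>, so the curve is built from the constant 1
  factor by factor.\<close>

lemma smooth_curve_padded_perm:
  assumes "n \<le> m"
    and "\<And>ij. zero_ext (E m) (\<lambda>M. A0 M ij) \<in> dual (E m)"
    and "\<And>ij. zero_ext (E m) (\<lambda>M. A1 M ij) \<in> dual (E m)"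
    and AE: "\<And>M e. M \<in> E m \<Longrightarrow> A0 M + fscale e (A1 M) \<in> E m"
  shows "smooth_curve (Q m) (\<lambda>e. zero_ext (E m) (\<lambda>M. padded_perm m n (A0 M + fscale e (A1 M))))"
proof -
  let ?I = "{m - n + 1..m}"
  define l0 l1 where "l0 ij = zero_ext (E m) (\<lambda>M. A0 M ij)" "l1 ij = zero_ext (E m) (\<lambda>M. A1 M ij)" for ij
  have l: "l0 ij \<in> dual (E m)" "l1 ij \<in> dual (E m)" for ij
    using assms by (simp_all add: l0_l1_def)
  let ?one = "zero_ext (E m) (\<lambda>_. 1)"
  have "?one \<in> sym_power_dual (E m) 0"
    unfolding sym_power_dual_def by (rule fun_space.span_base) (auto simp: dual_products_def)
  then have one: "smooth_curve (sym_power_dual (E m) 0) (\<lambda>_. ?one)"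
    by (rule smooth_curve_const[OF subspace_sym_power_dual])
  define \<gamma> where "\<gamma> \<pi> e = ?one * (\<lambda>M. \<Prod>j<m - n. l0 (1, 1) M + e * l1 (1, 1) M)
      * (\<lambda>M. \<Prod>i\<in>?I. l0 (i, \<pi> i) M + e * l1 (i, \<pi> i) M)" for \<pi> e
  have "smooth_curve (sym_power_dual (E m) (0 + card {..<m - n} + card ?I)) (\<gamma> \<pi>)" for \<pi>
    unfolding \<gamma>_def by (intro smooth_curve_mult_prod_affine one l) auto
  then have "smooth_curve (Q m) (\<gamma> \<pi>)" for \<pi>
    using \<open>n \<le> m\<close> by (simp add: Q_def)
  then have "smooth_curve (Q m) (\<lambda>e. \<Sum>\<pi> | \<pi> permutes ?I. \<gamma> \<pi> e)"
    by (intro smooth_curve_sum finite_permutations)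
      (auto simp: Q_def subspace_sym_power_dual)
  moreover have eq: "(\<Sum>\<pi> | \<pi> permutes ?I. \<gamma> \<pi> e)
      = zero_ext (E m) (\<lambda>M. padded_perm m n (A0 M + fscale e (A1 M)))" for e
  proof
    fix M
    have "(\<Sum>\<pi>\<in>P. \<gamma> \<pi> e) M = (\<Sum>\<pi>\<in>P. \<gamma> \<pi> e M)" for P
      by (induction P rule: infinite_finite_induct) auto
    then show "(\<Sum>\<pi> | \<pi> permutes ?I. \<gamma> \<pi> e) M
        = zero_ext (E m) (\<lambda>M. padded_perm m n (A0 M + fscale e (A1 M))) M"
      using AE[of M e]
      by (auto simp: \<gamma>_def l0_l1_def zero_ext_def padded_perm_def permanent_def fscale_def
          sum_distrib_left)
  qed
  ultimately show ?thesis unfolding eq by blast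
qed

section \<open>Extraction of polynomial coefficients by evaluation\<close>

text \<open>Discrete Fourier inversion: the points are the \<open>N\<close>-th roots of unity, whose
  powers satisfy the orthogonality relation \<open>orth\<close>.\<close>

lemma coeff_weights:
  "\<exists>(w :: nat \<Rightarrow> nat \<Rightarrow> complex) pt. \<forall>p j. Polynomial.degree p < N \<longrightarrow> j < N \<longrightarrow>
     (\<Sum>i<N. w j i * poly p (pt i)) = Polynomial.coeff p j"
proof (cases "N = 0")
  case True then show ?thesis by auto
next
  case False
  define \<omega> where "\<omega> k = cis (2 * pi * real k / real N)" for k
  have bij: "bij_betw \<omega> {..<N} {z. z ^ N = 1}"
    unfolding \<omega>_def using bij_betw_roots_unity[of N] False by blast
  have pow: "\<omega> i ^ k = \<omega> k ^ i" for i k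
    by (simp add: \<omega>_def DeMoivre mult_ac)
  have nz: "\<omega> k \<noteq> 0" for k by (simp add: \<omega>_def)
  define w where "w j i = inverse (\<omega> i ^ j) / of_nat N" for j i
  have orth: "(\<Sum>i<N. w j i * \<omega> i ^ k) = (if k = j then 1 else 0)" if "j < N" "k < N" for j k
  proof -
    have eq: "w j i * \<omega> i ^ k = (\<omega> k / \<omega> j) ^ i / of_nat N" for i
      by (simp add: w_def pow[of i] power_divide divide_simps)
    show ?thesis
    proof (cases "k = j")
      case True then show ?thesis unfolding eq using nz False by simp
    next
      case neq: False
      have "\<omega> k ^ N = 1" "\<omega> j ^ N = 1" using bij that by (auto simp: bij_betw_def)
      moreover have "\<omega> k \<noteq> \<omega> j" using bij that neq by (auto simp: bij_betw_def inj_on_def)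
      ultimately have "(\<Sum>i<N. (\<omega> k / \<omega> j) ^ i) = 0"
        using nz by (subst geometric_sum) (auto simp: power_divide)
      then show ?thesis using neq by (simp add: eq sum_divide_distrib[symmetric])
    qed
  qed
  have "(\<Sum>i<N. w j i * poly p (\<omega> i)) = Polynomial.coeff p j"
    if "Polynomial.degree p < N" "j < N" for p j
  proof -
    have "poly p x = (\<Sum>k<N. Polynomial.coeff p k * x ^ k)" for x
      unfolding poly_altdef using that
      by (intro sum.mono_neutral_left) (auto simp: coeff_eq_0)
    then have "(\<Sum>i<N. w j i * poly p (\<omega> i)) = (\<Sum>i<N. \<Sum>k<N. Polynomial.coeff p k * (w j i * \<omega> i ^ k))"
      by (simp add: sum_distrib_left mult_ac)
    also have "\<dots> = (\<Sum>k<N. Polynomial.coeff p k * (\<Sum>i<N. w j i * \<omega> i ^ k))"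
      by (subst sum.swap) (simp add: sum_distrib_left)
    also have "\<dots> = (\<Sum>k<N. if k = j then Polynomial.coeff p k else 0)"
      using that by (intro sum.cong) (auto simp: orth)
    also have "\<dots> = Polynomial.coeff p j" using that by simp
    finally show ?thesis .
  qed
  then show ?thesis by blast
qed

text \<open>A coefficient is a finite linear combination of values, so \<open>c i j\<close> is
  linear on all functions. It extracts the coefficient of \<open>x ^ i * z ^ j\<close> on the affine
  plane through \<open>v\<close> with directions \<open>u\<close> and \<open>w\<close>.\<close>

lemma coeff_functionals:
  fixes u v w :: "'x \<Rightarrow> complex" and N :: nat
  obtains c :: "nat \<Rightarrow> nat \<Rightarrow> (('x \<Rightarrow> complex) \<Rightarrow> complex) \<Rightarrow> complex"
  where "\<And>i j q r. c i j (q + r) = c i j q + c i j r"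
    and "\<And>i j b q. c i j (fscale b q) = b * c i j q"
    and "\<And>i j q t a1 a2 d \<phi>. \<lbrakk>i \<le> d; d + Polynomial.degree \<phi> < N; j < N;
        \<And>x z. q (fscale x u + v + fscale z w) = (t * x + a1 + a2 * z) ^ d * poly \<phi> z\<rbrakk> \<Longrightarrow>
      c i j q = of_nat (d choose i) * t ^ i * Polynomial.coeff ([:a1, a2:] ^ (d - i) * \<phi>) j"
proof -
  obtain \<alpha> :: "nat \<Rightarrow> nat \<Rightarrow> complex" and pt where \<alpha>:
    "\<And>p j. Polynomial.degree p < N \<Longrightarrow> j < N \<Longrightarrow>
      (\<Sum>i<N. \<alpha> j i * poly p (pt i)) = Polynomial.coeff p j"
    using coeff_weights[of N] by metis
  define c where "c i j q = (\<Sum>b<N. \<alpha> j b * (\<Sum>a<N. \<alpha> i a * q (fscale (pt a) u + v + fscale (pt b) w)))"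
    for i j and q :: "('x \<Rightarrow> complex) \<Rightarrow> complex"
  have add: "c i j (q + r) = c i j q + c i j r" for i j q r
    by (simp add: c_def algebra_simps sum.distrib sum_distrib_left)
  have scale: "c i j (fscale b q) = b * c i j q" for i j b q
    by (simp add: c_def fscale_def sum_distrib_left mult_ac)
  have coeff: "c i j q = of_nat (d choose i) * t ^ i * Polynomial.coeff ([:a1, a2:] ^ (d - i) * \<phi>) j"
    if "i \<le> d" "d + Polynomial.degree \<phi> < N" "j < N"
      and q: "\<And>x z. q (fscale x u + v + fscale z w) = (t * x + a1 + a2 * z) ^ d * poly \<phi> z"
    for i j q t a1 a2 d \<phi>
  proof -
    \<comment> \<open>For fixed \<open>z\<close> the power is the polynomial
      \<open>[:a1 + a2 * z, t:] ^ d\<close> in \<open>x\<close>, and the binomial theorem gives its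
      coefficient.\<close>
    have inner: "(\<Sum>a<N. \<alpha> i a * q (fscale (pt a) u + v + fscale z w))
        = of_nat (d choose i) * t ^ i * poly ([:a1, a2:] ^ (d - i) * \<phi>) z" for z
    proof -
      have "Polynomial.degree ([:a1 + a2 * z, t:] ^ d) \<le> d"
        using degree_power_le[of "[:a1 + a2 * z, t:]" d] by (simp split: if_splits)
      then have "(\<Sum>a<N. \<alpha> i a * poly ([:a1 + a2 * z, t:] ^ d) (pt a))
          = Polynomial.coeff ([:a1 + a2 * z, t:] ^ d) i"
        using that by (intro \<alpha>) auto
      also have "\<dots> = of_nat (d choose i) * t ^ i * (a1 + a2 * z) ^ (d - i)"
        using that by (simp add: coeff_linear_poly_power)
      finally have "(\<Sum>a<N. \<alpha> i a * poly ([:a1 + a2 * z, t:] ^ d) (pt a)) * poly \<phi> z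
          = of_nat (d choose i) * t ^ i * (a1 + a2 * z) ^ (d - i) * poly \<phi> z" by simp
      moreover have "(\<Sum>a<N. \<alpha> i a * q (fscale (pt a) u + v + fscale z w))
          = (\<Sum>a<N. \<alpha> i a * poly ([:a1 + a2 * z, t:] ^ d) (pt a)) * poly \<phi> z"
        unfolding sum_distrib_right q by (intro sum.cong) (simp_all add: algebra_simps)
      ultimately show ?thesis by (simp add: algebra_simps)
    qed
    have "Polynomial.degree ([:a1, a2:] ^ (d - i) * \<phi>) \<le> (d - i) + Polynomial.degree \<phi>"
      using degree_mult_le[of "[:a1, a2:] ^ (d - i)" \<phi>] degree_power_le[of "[:a1, a2:]" "d - i"]
      by (simp split: if_splits)
    then have "(\<Sum>b<N. \<alpha> j b * poly ([:a1, a2:] ^ (d - i) * \<phi>) (pt b))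
        = Polynomial.coeff ([:a1, a2:] ^ (d - i) * \<phi>) j"
      using that by (intro \<alpha>) auto
    moreover have "c i j q = of_nat (d choose i) * t ^ i
        * (\<Sum>b<N. \<alpha> j b * poly ([:a1, a2:] ^ (d - i) * \<phi>) (pt b))"
      unfolding c_def inner sum_distrib_left by (intro sum.cong) (simp_all only: mult_ac)
    ultimately show ?thesis by simp
  qed
  from add scale coeff show ?thesis by (rule that)
qed

subsection \<open>Elements of $R$ and their orbit points\<close>

text \<open>Describes \<open>g^{-1}\<close> rather than \<open>g\<close>, because \<open>act\<close>
  substitutes the inverse. The parameters enter linearly, so moving them along a line gives a smooth
  curve in \<open>Q m\<close>.\<close>

definition shear :: "'i \<Rightarrow> 'i \<Rightarrow> ('i \<Rightarrow> complex) \<Rightarrow> ('i \<Rightarrow> complex) \<Rightarrow> ('i \<Rightarrow> complex)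
    \<Rightarrow> ('i \<Rightarrow> complex) \<Rightarrow> 'i \<Rightarrow> complex" where
  "shear p q \<kappa> \<rho> \<sigma> M = (\<lambda>i. \<kappa> i * M i + \<rho> i * M p + \<sigma> i * M q)"

lemma shear_add: "shear p q \<kappa> \<rho> \<sigma> (M + N) = shear p q \<kappa> \<rho> \<sigma> M + shear p q \<kappa> \<rho> \<sigma> N"
  by (auto simp: shear_def fun_eq_iff algebra_simps)

lemma shear_scale: "shear p q \<kappa> \<rho> \<sigma> (fscale c M) = fscale c (shear p q \<kappa> \<rho> \<sigma> M)"
  by (auto simp: shear_def fun_eq_iff fscale_def algebra_simps)

lemma shear_param_add:
  "shear p q \<kappa> \<rho> \<sigma> M + fscale e (shear p q \<kappa>' \<rho>' \<sigma>' M)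
    = shear p q (\<lambda>i. \<kappa> i + e * \<kappa>' i) (\<lambda>i. \<rho> i + e * \<rho>' i) (\<lambda>i. \<sigma> i + e * \<sigma>' i) M"
  by (auto simp: shear_def fun_eq_iff fscale_def algebra_simps)

lemma shear_entry_in_dual:
  "zero_ext (E m) (\<lambda>M. shear p q \<kappa> \<rho> \<sigma> M ij) \<in> dual (E m)"
  by (rule dual_zero_ext[OF subspace_E]) (auto simp: shear_def fscale_def algebra_simps)

text \<open>Since \<open>\<rho>\<close> and \<open>\<sigma>\<close> vanish at \<open>p\<close> and
  \<open>q\<close>, these two entries are merely rescaled. The shear can therefore be solved for
  \<open>M\<close> explicitly, and its inverse \<open>T\<close> is again a shear; \<open>T\<close>
  restricted to \<open>E m\<close> is the required \<open>g\<close>.\<close>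

lemma shear_in_R:
  assumes J: "S_indices m n \<subseteq> {1..m} \<times> {1..m}"
      "p \<in> S_indices m n" "p \<noteq> (1, 1)" "q \<in> S_indices m n" "q \<noteq> (1, 1)"
    and \<kappa>: "\<And>i. \<kappa> i \<noteq> 0" "\<And>i. i \<notin> S_indices m n \<Longrightarrow> \<kappa> i = 1"
    and \<rho>\<sigma>: "\<And>i. i \<notin> S_indices m n \<or> i \<in> {p, q} \<Longrightarrow> \<rho> i = 0 \<and> \<sigma> i = 0"
  obtains g where "g \<in> R m n" "\<And>M. M \<in> E m \<Longrightarrow> inv_into (E m) g M = shear p q \<kappa> \<rho> \<sigma> M"
proof -
  define \<kappa>' \<rho>' \<sigma>' where "\<kappa>' i = 1 / \<kappa> i" and "\<rho>' i = - \<rho> i / (\<kappa> i * \<kappa> p)"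
    and "\<sigma>' i = - \<sigma> i / (\<kappa> i * \<kappa> q)" for i
  define T T' where "T = shear p q \<kappa>' \<rho>' \<sigma>'" and "T' = shear p q \<kappa> \<rho> \<sigma>"
  have zero: "\<rho> p = 0" "\<rho> q = 0" "\<sigma> p = 0" "\<sigma> q = 0" using \<rho>\<sigma> by auto
  have TT': "T (T' M) = M" and T'T: "T' (T M) = M" for M
    using \<kappa>(1)
    by (auto simp: T_def T'_def shear_def \<kappa>'_def \<rho>'_def \<sigma>'_def zero fun_eq_iff field_simps)
  define V where "V K = {M :: cmatrix. \<forall>i. i \<notin> K \<longrightarrow> M i = 0}" for K
  \<comment> \<open>The first alternative covers \<open>E m\<close> and \<open>S m n\<close>; the
    second covers the line of \<open>mat_unit (1, 1)\<close>, on which the entries to be added are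
    0.\<close>
  have pres: "T M \<in> V K" "T' M \<in> V K"
    if "S_indices m n \<subseteq> K \<or> p \<notin> K \<and> q \<notin> K" "M \<in> V K" for M K
  proof -
    have M: "M i = 0" if "i \<notin> K" for i
      using \<open>M \<in> V K\<close> that unfolding V_def mem_Collect_eq by blast
    have "T M i = 0 \<and> T' M i = 0" if "i \<notin> K" for i
    proof -
      have "\<rho> i = 0 \<or> M p = 0" "\<sigma> i = 0 \<or> M q = 0"
        using that \<open>S_indices m n \<subseteq> K \<or> p \<notin> K \<and> q \<notin> K\<close> \<rho>\<sigma>[of i] M[of p] M[of q] by auto
      then show ?thesis
        using M[OF that] by (auto simp: T_def T'_def shear_def \<kappa>'_def \<rho>'_def \<sigma>'_def)
    qed
    then show "T M \<in> V K" "T' M \<in> V K" unfolding V_def by blast+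
  qed
  have image: "T ` V K = V K" if "S_indices m n \<subseteq> K \<or> p \<notin> K \<and> q \<notin> K" for K
  proof
    show "T ` V K \<subseteq> V K" using pres that by blast
    show "V K \<subseteq> T ` V K" using pres(2)[OF that] TT' by (metis image_eqI subsetI)
  qed
  have E: "E m = V ({1..m} \<times> {1..m})" by (simp add: E_def V_def)
  have finJ: "finite (S_indices m n)" by (simp add: S_indices_def)
  have S: "S m n = V (S_indices m n)" by (simp add: S_def V_def span_mat_unit finJ)
  have S_perp: "S_perp m n = V ({1..m} \<times> {1..m} - S_indices m n)"
    unfolding S_perp_def V_def by (rule span_mat_unit) auto
  have line: "fun_space.span {mat_unit (1, 1)} = V {(1, 1)}"
    using span_mat_unit[of "{(1, 1)}"] by (simp add: V_def)
  have sub: "V K \<subseteq> E m" if "K \<subseteq> {1..m} \<times> {1..m}" for K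
    using that unfolding E V_def by blast
  have line_sub: "V {(1, 1)} \<subseteq> E m" using J(1) by (intro sub) (auto simp: S_indices_def)
  \<comment> \<open>\<open>Bij\<close> consists of extensional maps, so \<open>T\<close> has to be
    cut off outside \<open>E m\<close>.\<close>
  define g where "g = restrict T (E m)"
  have g_image: "g ` U = T ` U" if "U \<subseteq> E m" for U
    using that by (intro image_cong) (auto simp: g_def)
  have bij: "bij_betw T (E m) (E m)"
    unfolding bij_betw_def using image[of "{1..m} \<times> {1..m}"] J(1) TT' T'T
    by (metis E inj_on_inverseI)
  have "g \<in> Bij (E m)"
    using bij by (simp add: Bij_def g_def bij_betw_restrict_eq)
  moreover have closed: "u + v \<in> E m" "fscale c u \<in> E m" if "u \<in> E m" "v \<in> E m" for u v c
    using that subspace_E by (auto simp: fun_space.subspace_add fun_space.subspace_scale)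
  ultimately have "g \<in> GL (E m)"
    unfolding GL_def using closed by (auto simp: g_def T_def shear_add shear_scale)
  moreover have "g ` S m n = S m n"
    using image[of "S_indices m n"] g_image[OF sub[OF J(1)]] unfolding S by simp
  moreover have "g M = M" if "M \<in> S_perp m n" for M
  proof -
    have M: "M \<in> V ({1..m} \<times> {1..m} - S_indices m n)" using that S_perp by simp
    then have "M \<in> E m" using sub by blast
    moreover have "T M i = M i" for i
    proof (cases "i \<in> S_indices m n")
      case True
      then have "M i = 0" "M p = 0" "M q = 0" using M J by (auto simp: V_def)
      then show ?thesis by (simp add: T_def shear_def)
    next
      case False
      then show ?thesis using \<kappa>(2) \<rho>\<sigma> by (simp add: T_def shear_def \<kappa>'_def \<rho>'_def \<sigma>'_def)
    qed
    ultimately show ?thesis by (auto simp: g_def)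
  qed
  moreover have "g ` fun_space.span {mat_unit (1, 1)} = fun_space.span {mat_unit (1, 1)}"
    using image[of "{(1, 1)}"] g_image[OF line_sub] J unfolding line by simp
  ultimately have "g \<in> R m n" by (simp add: R_def L2_P_def)
  moreover have "inv_into (E m) g M = shear p q \<kappa> \<rho> \<sigma> M" if M: "M \<in> E m" for M
  proof (rule inv_into_f_eq)
    show "inj_on g (E m)" using bij by (simp add: g_def bij_betw_def inj_on_restrict_eq)
    show mem: "shear p q \<kappa> \<rho> \<sigma> M \<in> E m"
      using pres(2)[of "{1..m} \<times> {1..m}" M] M J(1) by (simp add: E T'_def)
    show "g (shear p q \<kappa> \<rho> \<sigma> M) = M"
      using mem TT' by (simp add: g_def T'_def)
  qed
  ultimately show ?thesis by (rule that)
qed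

lemma GL_inv_into:
  assumes "g \<in> GL V" and V: "fun_space.subspace V"
  shows "v \<in> V \<Longrightarrow> inv_into V g v \<in> V"
    and "u \<in> V \<Longrightarrow> v \<in> V \<Longrightarrow> inv_into V g (u + v) = inv_into V g u + inv_into V g v"
    and "v \<in> V \<Longrightarrow> inv_into V g (fscale c v) = fscale c (inv_into V g v)"
proof -
  have bij: "bij_betw g V V" using assms by (simp add: GL_def Bij_def)
  note right = bij_betw_inv_into_right[OF bij] and left = bij_betw_inv_into_left[OF bij]
  have mem: "inv_into V g v \<in> V" if "v \<in> V" for v
    using bij_betw_inv_into[OF bij] that by (auto simp: bij_betw_def)
  then show "v \<in> V \<Longrightarrow> inv_into V g v \<in> V" .
  show "inv_into V g (u + v) = inv_into V g u + inv_into V g v" if "u \<in> V" "v \<in> V"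
  proof -
    have "g (inv_into V g u + inv_into V g v) = u + v"
      using assms(1) mem right that by (simp add: GL_def)
    then show ?thesis
      using left[of "inv_into V g u + inv_into V g v"] mem that V
      by (simp add: fun_space.subspace_add)
  qed
  show "inv_into V g (fscale c v) = fscale c (inv_into V g v)" if "v \<in> V"
  proof -
    have "g (fscale c (inv_into V g v)) = fscale c v"
      using assms(1) mem right that by (simp add: GL_def)
    then show ?thesis
      using left[of "fscale c (inv_into V g v)"] mem that V
      by (simp add: fun_space.subspace_scale)
  qed
qed

text \<open>Every permutation other than \<open>id\<close> picks up an off-diagonal entry.\<close>

lemma permanent_diagonal:
  assumes "finite I" and off: "\<And>i j. i \<in> I \<Longrightarrow> j \<in> I \<Longrightarrow> i \<noteq> j \<Longrightarrow> M (i, j) = 0"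
  shows "permanent I M = (\<Prod>i\<in>I. M (i, i))"
proof -
  have "(\<Prod>i\<in>I. M (i, \<pi> i)) = 0" if \<pi>: "\<pi> permutes I" "\<pi> \<noteq> id" for \<pi>
  proof -
    obtain i where "\<pi> i \<noteq> i" using \<pi>(2) by (auto simp: fun_eq_iff)
    then have "i \<in> I" "\<pi> i \<in> I" using \<pi>(1) by (metis permutes_not_in permutes_in_image)+
    then show ?thesis
      using off[of i "\<pi> i"] \<open>\<pi> i \<noteq> i\<close> assms(1) by (intro prod_zero bexI[of _ i]) auto
  qed
  then have "permanent I M = (\<Sum>\<pi>\<in>{id}. \<Prod>i\<in>I. M (i, \<pi> i))"
    unfolding permanent_def using assms(1)
    by (intro sum.mono_neutral_right) (auto simp: finite_permutations permutes_id)
  then show ?thesis by simp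
qed

section \<open>The orbit and its restriction to planes\<close>

text \<open>The bound on \<open>n\<close> places the entries \<open>(m, m - 1)\<close> and
  \<open>(m - 1, m - 1)\<close> in the block; the bound on \<open>m\<close> makes the exponents
  \<open>m - n - i\<close> with \<open>i \<le> 2\<close> genuine differences.\<close>

locale padded =
  fixes m n :: nat
  assumes n: "2 \<le> n" and m: "n + 2 \<le> m"
begin

abbreviation "block \<equiv> {m - n + 1..m}"

definition orbit where "orbit = (\<lambda>g. act (E m) g (padded_perm m n)) ` R m n"

lemma S_indices_subset: "S_indices m n \<subseteq> {1..m} \<times> {1..m}"
  using n m by (auto simp: S_indices_def)

lemma mat_unit_in_E: "ij \<in> S_indices m n \<Longrightarrow> mat_unit ij \<in> E m"
  using S_indices_subset by (auto simp: E_def mat_unit_def)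

text \<open>Membership is read off from the constant curve that
  \<open>smooth_curve_padded_perm\<close> yields for direction 0.\<close>

lemma orbit_subset_Q: "orbit \<subseteq> Q m"
proof
  fix f assume "f \<in> orbit"
  then obtain g where g: "g \<in> R m n" and f: "f = act (E m) g (padded_perm m n)"
    by (auto simp: orbit_def)
  have GL: "g \<in> GL (E m)" using g by (simp add: R_def L2_P_def)
  note h = GL_inv_into[OF GL subspace_E]
  have "smooth_curve (Q m)
      (\<lambda>e. zero_ext (E m) (\<lambda>M. padded_perm m n (inv_into (E m) g M + fscale e 0)))"
  proof (rule smooth_curve_padded_perm)
    show "n \<le> m" using m by simp
    show "zero_ext (E m) (\<lambda>M. inv_into (E m) g M ij) \<in> dual (E m)" for ij
      by (rule dual_zero_ext[OF subspace_E]) (simp_all only: h, simp_all add: fscale_def)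
    show "zero_ext (E m) (\<lambda>M. (0 :: cmatrix) ij) \<in> dual (E m)" for ij
      by (rule dual_zero_ext[OF subspace_E]) simp_all
    show "inv_into (E m) g M + fscale e 0 \<in> E m" if "M \<in> E m" for M e
      using h(1)[OF that] by simp
  qed
  from smooth_curveD[OF this, of 0] show "f \<in> Q m" by (simp add: f act_def)
qed

lemma orbit_subset: "orbit \<subseteq> R_orbit_closure m n"
  using orbit_subset_Q by (auto simp: R_orbit_closure_def zariski_closure_def orbit_def)

text \<open>As \<open>g\<close> stabilizes the line of \<open>mat_unit (1, 1)\<close>, its inverse
  maps this matrix unit to a multiple \<open>t\<close> of itself. Hence \<open>x\<close> enters only
  the padding factor, while the permanent is a polynomial in \<open>z\<close> alone.\<close>

lemma orbit_on_plane:
  assumes "f \<in> orbit" "u \<in> E m" "v \<in> E m"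
  obtains t a1 a2 \<phi> where "Polynomial.degree \<phi> \<le> n"
    and "\<And>x z. f (fscale x (mat_unit (1, 1)) + u + fscale z v) = (t * x + a1 + a2 * z) ^ (m - n) * poly \<phi> z"
proof -
  obtain g where g: "g \<in> R m n" and f: "f = act (E m) g (padded_perm m n)"
    using assms by (auto simp: orbit_def)
  let ?h = "inv_into (E m) g" and ?e = "mat_unit (1, 1) :: cmatrix"
  have GL: "g \<in> GL (E m)" using g by (simp add: R_def L2_P_def)
  note h = GL_inv_into[OF GL subspace_E]
  have e: "?e \<in> E m" by (rule mat_unit_in_E) (simp add: S_indices_def)
  have "?e \<in> g ` fun_space.span {?e}"
    using g fun_space.span_base[of ?e "{?e}"] by (simp add: R_def)
  then obtain t where t: "?e = g (fscale t ?e)"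
    by (auto simp: fun_space.span_singleton)
  have "inj_on g (E m)" using GL by (simp add: GL_def Bij_def bij_betw_def)
  then have he: "?h ?e = fscale t ?e"
    by (rule inv_into_f_eq) (use t e subspace_E in \<open>auto simp: fun_space.subspace_scale\<close>)
  define \<phi> where "\<phi> = (\<Sum>\<pi> | \<pi> permutes block. \<Prod>i\<in>block. [:?h u (i, \<pi> i), ?h v (i, \<pi> i):])"
  have "Polynomial.degree \<phi> \<le> n"
    unfolding \<phi>_def
  proof (rule degree_sum_le)
    fix \<pi>
    have "Polynomial.degree (\<Prod>i\<in>block. [:?h u (i, \<pi> i), ?h v (i, \<pi> i):])
        \<le> (\<Sum>i\<in>block. Polynomial.degree [:?h u (i, \<pi> i), ?h v (i, \<pi> i):])"
      by (rule degree_prod_sum_le[OF finite_atLeastAtMost, unfolded o_def])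
    also have "\<dots> \<le> (\<Sum>i\<in>block. 1)" by (intro sum_mono) simp
    also have "\<dots> \<le> n" by simp
    finally show "Polynomial.degree (\<Prod>i\<in>block. [:?h u (i, \<pi> i), ?h v (i, \<pi> i):]) \<le> n" .
  qed (simp add: finite_permutations)
  moreover have "f (fscale x ?e + u + fscale z v)
      = (t * x + ?h u (1, 1) + ?h v (1, 1) * z) ^ (m - n) * poly \<phi> z" for x z
  proof -
    let ?M = "fscale x ?e + u + fscale z v"
    have sub: "fscale x ?e \<in> E m" "fscale z v \<in> E m" "fscale x ?e + u \<in> E m" "?M \<in> E m"
      using e assms subspace_E by (simp_all add: fun_space.subspace_scale fun_space.subspace_add)
    have hM: "?h ?M = fscale x (fscale t ?e) + ?h u + fscale z (?h v)"
      using sub e assms by (simp only: h he)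
    have "?h ?M (i, j) = ?h u (i, j) + z * ?h v (i, j)" if "i \<in> block" for i j
      using that m unfolding hM by (auto simp: fscale_def mat_unit_def)
    then have "permanent block (?h ?M) = poly \<phi> z"
      by (auto simp: permanent_def \<phi>_def poly_sum poly_prod mult.commute intro!: sum.cong prod.cong)
    moreover have "?h ?M (1, 1) = t * x + ?h u (1, 1) + ?h v (1, 1) * z"
      unfolding hM by (simp add: fscale_def mat_unit_def)
    ultimately show ?thesis
      using sub h(1)[OF sub(4)] by (simp add: f act_def zero_ext_def padded_perm_def)
  qed
  ultimately show ?thesis by (rule that)
qed

subsection \<open>Non-normality\<close>

text \<open>The entries \<open>M p\<close> and \<open>M q\<close> are the coordinates
  \<open>y\<close> and \<open>z\<close>; the plane used below is dehomogenized by
  \<open>y = 1\<close>.\<close>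

abbreviation "p \<equiv> (m, m)"
abbreviation "q \<equiv> (m, m - 1)"

lemma pq_in_S_indices: "p \<in> S_indices m n" "p \<noteq> (1, 1)" "q \<in> S_indices m n" "q \<noteq> (1, 1)" "p \<noteq> q"
  using n m by (auto simp: S_indices_def)

text \<open>A product of linear forms is the permanent of a diagonal matrix, and so a degeneration of the
  permanent of a generic matrix.\<close>

definition degen :: "complex \<Rightarrow> complex \<Rightarrow> complex \<Rightarrow> complex \<Rightarrow> cmatrix \<Rightarrow> complex" where
  "degen k s a b = zero_ext (E m) (\<lambda>M. k * (M (1, 1) + s * (M p + a * M q)) ^ (m - n)
     * (M p ^ (n - 1) * (M p + b * M q)))"

text \<open>Together with \<open>\<rho>0\<close> and \<open>\<sigma>0 b\<close> this makes the block
  diagonal, with entries \<open>k * M p\<close> at \<open>m\<close>, \<open>M p + b * M q\<close> at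
  \<open>m - 1\<close>, and \<open>M p\<close> elsewhere. \<open>at_11\<close> produces the linear
  form in the padding factor.\<close>

definition \<kappa>0 :: "complex \<Rightarrow> nat \<times> nat \<Rightarrow> complex" where
  "\<kappa>0 k ij = (if ij = p then k else if ij \<in> block \<times> block then 0 else 1)"

text \<open>The direction of deformation: \<open>\<kappa>0 k + e * \<kappa>1\<close> has no zeros
  when \<open>k\<close> and \<open>e\<close> are nonzero, so the deformed shear is
  invertible.\<close>

definition \<kappa>1 :: "nat \<times> nat \<Rightarrow> complex" where
  "\<kappa>1 ij = (if ij \<in> block \<times> block - {p} then 1 else 0)"

definition \<rho>0 :: "nat \<times> nat \<Rightarrow> complex" where
  "\<rho>0 ij = (if ij \<in> block \<times> block - {p} \<and> fst ij = snd ij then 1 else 0)"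

definition \<sigma>0 :: "complex \<Rightarrow> nat \<times> nat \<Rightarrow> complex" where
  "\<sigma>0 b ij = (if ij = (m - 1, m - 1) then b else 0)"

definition at_11 :: "complex \<Rightarrow> nat \<times> nat \<Rightarrow> complex" where
  "at_11 s ij = (if ij = (1, 1) then s else 0)"

section \<open>Degenerate shears as limits of invertible ones\<close>

lemma shear_in_E:
  assumes "M \<in> E m" and "\<And>ij. ij \<notin> S_indices m n \<Longrightarrow> \<rho> ij = 0 \<and> \<sigma> ij = 0"
  shows "shear p q \<kappa> \<rho> \<sigma> M \<in> E m"
proof -
  have "M ij = 0 \<and> \<rho> ij = 0 \<and> \<sigma> ij = 0" if "ij \<notin> {1..m} \<times> {1..m}" for ij
    using that assms S_indices_subset unfolding E_def by blast
  then show ?thesis unfolding E_def shear_def by auto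
qed

lemma degenerate_shear:
  "zero_ext (E m) (\<lambda>M. padded_perm m n
     (shear p q (\<kappa>0 k) (\<lambda>ij. \<rho>0 ij + at_11 s ij) (\<lambda>ij. \<sigma>0 b ij + at_11 (s * a) ij) M)) = degen k s a b"
proof
  fix M
  let ?T = "shear p q (\<kappa>0 k) (\<lambda>ij. \<rho>0 ij + at_11 s ij) (\<lambda>ij. \<sigma>0 b ij + at_11 (s * a) ij) M"
  have ne: "(1::nat) \<notin> block" "m - 1 \<in> block" "m \<in> block" "m - 1 \<noteq> m" using n m by auto
  have "permanent block ?T = (\<Prod>i\<in>block. ?T (i, i))"
    using ne by (intro permanent_diagonal) (auto simp: shear_def \<kappa>0_def \<rho>0_def \<sigma>0_def at_11_def)
  \<comment> \<open>Splits off the two exceptional diagonal entries; the other \<open>n - 2\<close>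
    are all equal to \<open>M p\<close>.\<close>
  also have "\<dots> = (\<Prod>i\<in>insert m (insert (m - 1) {m - n + 1..m - 2}). ?T (i, i))"
    using n m by (intro prod.cong) auto
  also have "\<dots> = ?T p * (?T (m - 1, m - 1) * (\<Prod>i\<in>{m - n + 1..m - 2}. ?T (i, i)))"
    using n m by (subst prod.insert | force)+
  also have "(\<Prod>i\<in>{m - n + 1..m - 2}. ?T (i, i)) = (\<Prod>i\<in>{m - n + 1..m - 2}. M p)"
    using n m by (intro prod.cong) (auto simp: shear_def \<kappa>0_def \<rho>0_def \<sigma>0_def at_11_def)
  also have "\<dots> = M p ^ (n - 2)"
  proof -
    have "m - Suc (Suc (m - n)) = n - 2" using n m by simp
    then show ?thesis by simp
  qed
  also have "?T p = k * M p"
    using n m by (simp add: shear_def \<kappa>0_def \<rho>0_def \<sigma>0_def at_11_def)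
  also have "?T (m - 1, m - 1) = M p + b * M q"
    using ne n m by (auto simp: shear_def \<kappa>0_def \<rho>0_def \<sigma>0_def at_11_def)
  also have "k * M p * ((M p + b * M q) * M p ^ (n - 2)) = k * (M p ^ (n - 1) * (M p + b * M q))"
  proof -
    have "n - 1 = Suc (n - 2)" using n by simp
    then show ?thesis by simp
  qed
  finally have "permanent block ?T = k * (M p ^ (n - 1) * (M p + b * M q))" .
  moreover have "?T (1, 1) = M (1, 1) + s * (M p + a * M q)"
    using ne n m by (auto simp: shear_def \<kappa>0_def \<rho>0_def \<sigma>0_def at_11_def algebra_simps)
  moreover have "?T \<in> E m" if "M \<in> E m"
    using that pq_in_S_indices ne
    by (intro shear_in_E) (auto simp: \<rho>0_def \<sigma>0_def at_11_def S_indices_def)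
  ultimately show "zero_ext (E m) (\<lambda>M. padded_perm m n
     (shear p q (\<kappa>0 k) (\<lambda>ij. \<rho>0 ij + at_11 s ij) (\<lambda>ij. \<sigma>0 b ij + at_11 (s * a) ij) M)) M = degen k s a b M"
    by (simp add: zero_ext_def padded_perm_def degen_def)
qed

lemma smooth_curve_shear:
  assumes "\<And>ij. ij \<notin> S_indices m n \<Longrightarrow> \<rho> ij = 0 \<and> \<sigma> ij = 0"
    and "\<And>ij. ij \<notin> S_indices m n \<Longrightarrow> \<rho>' ij = 0 \<and> \<sigma>' ij = 0"
  shows "smooth_curve (Q m) (\<lambda>e. zero_ext (E m) (\<lambda>M. padded_perm m n
    (shear p q (\<lambda>i. \<kappa> i + e * \<kappa>' i) (\<lambda>i. \<rho> i + e * \<rho>' i) (\<lambda>i. \<sigma> i + e * \<sigma>' i) M)))"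
proof -
  have "smooth_curve (Q m) (\<lambda>e. zero_ext (E m) (\<lambda>M. padded_perm m n
    (shear p q \<kappa> \<rho> \<sigma> M + fscale e (shear p q \<kappa>' \<rho>' \<sigma>' M))))"
  proof (rule smooth_curve_padded_perm)
    show "n \<le> m" using m by simp
    show "shear p q \<kappa> \<rho> \<sigma> M + fscale e (shear p q \<kappa>' \<rho>' \<sigma>' M) \<in> E m" if "M \<in> E m" for M e
      unfolding shear_param_add using that assms by (intro shear_in_E) auto
  qed (rule shear_entry_in_dual)+
  then show ?thesis unfolding shear_param_add .
qed

lemma at_11_outside: "ij \<notin> S_indices m n \<Longrightarrow> at_11 s ij = 0"
  by (auto simp: at_11_def S_indices_def)

lemma \<rho>0_\<sigma>0_outside: "ij \<notin> S_indices m n \<Longrightarrow> \<rho>0 ij = 0 \<and> \<sigma>0 b ij = 0"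
  using n m by (auto simp: \<rho>0_def \<sigma>0_def S_indices_def)

text \<open>The point is the value at \<open>e = 0\<close> of a smooth curve that lies in the orbit
  for \<open>e \<noteq> 0\<close>. A polynomial function vanishing on the orbit is continuous along
  this curve, hence vanishes at its limit.\<close>

lemma degen_in_closure:
  assumes "k \<noteq> 0"
  shows "degen k s a b \<in> R_orbit_closure m n"
proof -
  let ?\<rho> = "\<lambda>ij. \<rho>0 ij + at_11 s ij" and ?\<sigma> = "\<lambda>ij. \<sigma>0 b ij + at_11 (s * a) ij"
  define \<gamma> where "\<gamma> e = zero_ext (E m) (\<lambda>M. padded_perm m n
    (shear p q (\<lambda>i. \<kappa>0 k i + e * \<kappa>1 i) (\<lambda>i. ?\<rho> i + e * 0) (\<lambda>i. ?\<sigma> i + e * 0) M))" for e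
  have \<gamma>: "smooth_curve (Q m) \<gamma>"
    unfolding \<gamma>_def by (rule smooth_curve_shear) (auto simp: at_11_outside \<rho>0_\<sigma>0_outside)
  have degen: "\<gamma> 0 = degen k s a b"
    unfolding degenerate_shear[symmetric] \<gamma>_def by simp
  have orbit: "\<gamma> e \<in> orbit" if e: "e \<noteq> 0" for e
  proof -
    obtain g where g: "g \<in> R m n"
      and inv: "\<And>M. M \<in> E m \<Longrightarrow> inv_into (E m) g M = shear p q (\<lambda>i. \<kappa>0 k i + e * \<kappa>1 i) ?\<rho> ?\<sigma> M"
    proof (rule shear_in_R[OF S_indices_subset pq_in_S_indices(1-4)])
      show "\<kappa>0 k i + e * \<kappa>1 i \<noteq> 0" for i
        using assms e n m by (auto simp: \<kappa>0_def \<kappa>1_def)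
      show "\<kappa>0 k i + e * \<kappa>1 i = 1" if "i \<notin> S_indices m n" for i
        using that n m by (auto simp: \<kappa>0_def \<kappa>1_def S_indices_def)
      show "?\<rho> i = 0 \<and> ?\<sigma> i = 0" if "i \<notin> S_indices m n \<or> i \<in> {p, q}" for i
        using that
      proof
        assume "i \<in> {p, q}"
        then show ?thesis using n m by (auto simp: \<rho>0_def \<sigma>0_def at_11_def)
      qed (simp add: at_11_outside \<rho>0_\<sigma>0_outside)
    qed blast
    have "\<gamma> e = act (E m) g (padded_perm m n)"
      by (auto simp: \<gamma>_def act_def zero_ext_def inv fun_eq_iff)
    then show ?thesis using g by (auto simp: orbit_def)
  qed
  have "F (degen k s a b) = 0" if F: "F \<in> poly_funs (Q m)" "\<forall>f\<in>orbit. F f = 0" for F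
  proof -
    have "(\<lambda>e. F (\<gamma> e)) \<midarrow>0\<rightarrow> F (\<gamma> 0)"
      using isCont_poly_fun_smooth_curve[OF \<gamma> F(1), of 0] by (simp add: isCont_def)
    moreover have "(\<lambda>e. F (\<gamma> e)) \<midarrow>0\<rightarrow> 0"
      by (rule LIM_equal2[of 1 _ _ "\<lambda>_. 0"]) (use orbit F(2) in auto)
    ultimately have "F (\<gamma> 0) = 0" by (rule LIM_unique)
    then show ?thesis by (simp add: degen)
  qed
  moreover have "degen k s a b \<in> Q m" using smooth_curveD[OF \<gamma>, of 0] by (simp add: degen)
  ultimately show ?thesis
    by (auto simp: R_orbit_closure_def zariski_closure_def orbit_def)
qed

text \<open>Smoothness provides a tangent vector at \<open>s = 0\<close>; it is identified by
  testing with evaluations at matrices \<open>M\<close>, which are linear on \<open>Q m\<close>. The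
  resulting formula is symmetric in \<open>a\<close> and \<open>b\<close>.\<close>

lemma degen_tangent:
  "\<exists>w\<in>Q m. (\<forall>l\<in>dual (Q m). ((\<lambda>s. l (degen 1 s a b)) has_field_derivative l w) (at 0)) \<and>
     w = zero_ext (E m) (\<lambda>M. of_nat (m - n) * M (1, 1) ^ (m - n - 1) * (M p + a * M q)
       * (M p ^ (n - 1) * (M p + b * M q)))"
proof -
  have "smooth_curve (Q m) (\<lambda>s. zero_ext (E m) (\<lambda>M. padded_perm m n
     (shear p q (\<lambda>ij. \<kappa>0 1 ij + s * 0) (\<lambda>ij. \<rho>0 ij + s * at_11 1 ij) (\<lambda>ij. \<sigma>0 b ij + s * at_11 a ij) M)))"
    by (rule smooth_curve_shear) (auto simp: at_11_outside \<rho>0_\<sigma>0_outside)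
  moreover have "s * at_11 c ij = at_11 (s * c) ij" for s c ij by (simp add: at_11_def)
  ultimately have "smooth_curve (Q m) (\<lambda>s. degen 1 s a b)"
    unfolding degenerate_shear[symmetric] by simp
  then obtain w where w: "w \<in> Q m"
    and d: "\<And>l. l \<in> dual (Q m) \<Longrightarrow> ((\<lambda>s. l (degen 1 s a b)) has_field_derivative l w) (at 0)"
    and mem: "\<And>s. degen 1 s a b \<in> Q m"
    using smooth_curve_deriv[of "Q m" _ 0] smooth_curveD by metis
  have "w M = zero_ext (E m) (\<lambda>M. of_nat (m - n) * M (1, 1) ^ (m - n - 1) * (M p + a * M q)
       * (M p ^ (n - 1) * (M p + b * M q))) M" for M
  proof -
    have "zero_ext (Q m) (\<lambda>f. f M) \<in> dual (Q m)"
      unfolding Q_def by (rule dual_zero_ext[OF subspace_sym_power_dual]) (auto simp: fscale_def)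
    from d[OF this] have d1: "((\<lambda>s. degen 1 s a b M) has_field_derivative w M) (at 0)"
      using w mem by (simp add: zero_ext_def)
    show ?thesis
    proof (cases "M \<in> E m")
      case True
      have "((\<lambda>s. (M (1, 1) + s * (M p + a * M q)) ^ (m - n) * (M p ^ (n - 1) * (M p + b * M q)))
        has_field_derivative of_nat (m - n) * M (1, 1) ^ (m - n - 1) * (M p + a * M q)
          * (M p ^ (n - 1) * (M p + b * M q))) (at 0)"
        by (auto intro!: derivative_eq_intros)
      then show ?thesis
        using d1 True by (auto simp: degen_def zero_ext_def intro: DERIV_unique)
    next
      case False
      then have "((\<lambda>s. degen 1 s a b M) has_field_derivative 0) (at 0)" by (simp add: degen_def zero_ext_def)
      then show ?thesis using d1 False by (auto simp: zero_ext_def intro: DERIV_unique)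
    qed
  qed
  then show ?thesis using w d by blast
qed

text \<open>Puts the limit points in the form of \<open>orbit_on_plane\<close> with
  \<open>t = 1\<close>, so that one coefficient formula serves both kinds of points.\<close>

lemma degen_on_plane:
  "degen k s a b (fscale x (mat_unit (1, 1)) + mat_unit p + fscale z (mat_unit q))
    = (1 * x + s + s * a * z) ^ (m - n) * poly [:k, k * b:] z"
proof -
  have "fscale x (mat_unit (1, 1)) + mat_unit p + fscale z (mat_unit q) \<in> E m"
    using subspace_E mat_unit_in_E pq_in_S_indices
    by (auto simp: fun_space.subspace_add fun_space.subspace_scale S_indices_def)
  then show ?thesis
    using pq_in_S_indices m n
    by (auto simp: degen_def zero_ext_def fscale_def mat_unit_def algebra_simps)
qed

lemma degen_scale: "degen k s a b = fscale k (degen 1 s a b)"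
  by (auto simp: degen_def zero_ext_def fscale_def)

text \<open>\<open>l i j\<close> is the coefficient of \<open>x ^ (m - n - i) * z ^ j\<close> on the plane spanned by the
  matrix units at \<open>(1, 1)\<close>, \<open>p\<close> and \<open>q\<close>, divided by a binomial coefficient.\<close>

lemma coordinate_functionals:
  obtains l :: "nat \<Rightarrow> nat \<Rightarrow> (cmatrix \<Rightarrow> complex) \<Rightarrow> complex"
  where "\<And>i j. l i j \<in> dual (Q m)"
    and "\<And>f. f \<in> orbit \<Longrightarrow> \<exists>t a1 a2 \<phi>. \<forall>i\<le>2. \<forall>j\<le>2.
      l i j f = t ^ (m - n - i) * Polynomial.coeff ([:a1, a2:] ^ i * \<phi>) j"
    and "\<And>k s a b i j. k \<noteq> 0 \<Longrightarrow> i \<le> 2 \<Longrightarrow> j \<le> 2 \<Longrightarrow>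
      l i j (degen k s a b) = Polynomial.coeff ([:s, s * a:] ^ i * [:k, k * b:]) j"
proof -
  \<comment> \<open>\<open>N = Suc m\<close> exceeds the degree bound
    \<open>(m - n) + n = m\<close>.\<close>
  obtain c :: "nat \<Rightarrow> nat \<Rightarrow> (cmatrix \<Rightarrow> complex) \<Rightarrow> complex" where
    add: "\<And>i j f g. c i j (f + g) = c i j f + c i j g"
    and scale: "\<And>i j r f. c i j (fscale r f) = r * c i j f"
    and coeff: "\<And>i j f t a1 a2 d \<phi>. \<lbrakk>i \<le> d; d + Polynomial.degree \<phi> < Suc m; j < Suc m;
        \<And>x z. f (fscale x (mat_unit (1, 1)) + mat_unit p + fscale z (mat_unit q))
          = (t * x + a1 + a2 * z) ^ d * poly \<phi> z\<rbrakk> \<Longrightarrow>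
      c i j f = of_nat (d choose i) * t ^ i * Polynomial.coeff ([:a1, a2:] ^ (d - i) * \<phi>) j"
    using coeff_functionals[where u = "mat_unit (1, 1) :: cmatrix" and v = "mat_unit p"
        and w = "mat_unit q" and N = "Suc m"] by blast
  define l where "l i j = zero_ext (Q m) (\<lambda>f. c (m - n - i) j f / of_nat ((m - n) choose (m - n - i)))" for i j
  have l_dual: "l i j \<in> dual (Q m)" for i j
    unfolding l_def Q_def
    by (rule dual_zero_ext[OF subspace_sym_power_dual]) (simp_all add: add scale add_divide_distrib)
  have eq: "l i j f = t ^ (m - n - i) * Polynomial.coeff ([:a1, a2:] ^ i * \<phi>) j"
    if "f \<in> Q m" "Polynomial.degree \<phi> \<le> n" "i \<le> 2" "j \<le> 2"
      and "\<And>x z. f (fscale x (mat_unit (1, 1)) + mat_unit p + fscale z (mat_unit q))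
          = (t * x + a1 + a2 * z) ^ (m - n) * poly \<phi> z" for i j f t a1 a2 \<phi>
  proof -
    have "m - n - (m - n - i) = i" using that m n by simp
    then have "c (m - n - i) j f = of_nat ((m - n) choose (m - n - i)) * t ^ (m - n - i)
        * Polynomial.coeff ([:a1, a2:] ^ i * \<phi>) j"
      using coeff[of "m - n - i" "m - n" \<phi> j f t a1 a2] that m n by simp
    moreover have "(m - n) choose (m - n - i) \<noteq> 0" by (simp add: binomial_eq_0_iff)
    ultimately show ?thesis using that(1) by (simp add: l_def zero_ext_def)
  qed
  have "\<exists>t a1 a2 \<phi>. \<forall>i\<le>2. \<forall>j\<le>2.
      l i j f = t ^ (m - n - i) * Polynomial.coeff ([:a1, a2:] ^ i * \<phi>) j" if f: "f \<in> orbit" for f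
  proof -
    have "mat_unit p \<in> E m" "mat_unit q \<in> E m" using mat_unit_in_E pq_in_S_indices by auto
    then obtain t a1 a2 \<phi> where "Polynomial.degree \<phi> \<le> n"
      "\<And>x z. f (fscale x (mat_unit (1, 1)) + mat_unit p + fscale z (mat_unit q))
          = (t * x + a1 + a2 * z) ^ (m - n) * poly \<phi> z"
      using orbit_on_plane[OF f] by metis
    then have "\<forall>i\<le>2. \<forall>j\<le>2. l i j f = t ^ (m - n - i) * Polynomial.coeff ([:a1, a2:] ^ i * \<phi>) j"
      using eq f orbit_subset_Q by blast
    then show ?thesis by blast
  qed
  moreover have "l i j (degen k s a b) = Polynomial.coeff ([:s, s * a:] ^ i * [:k, k * b:]) j"
    if "k \<noteq> 0" "i \<le> 2" "j \<le> 2" for k s a b i j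
  proof -
    have "degen k s a b \<in> Q m"
      using degen_in_closure[OF that(1)] by (simp add: R_orbit_closure_def zariski_closure_def)
    from eq[OF this _ that(2,3) degen_on_plane] n show ?thesis by simp
  qed
  ultimately show ?thesis using l_dual by (intro that)
qed

section \<open>The integral function that is not regular\<close>

lemma not_normal: "\<not> normal_variety (Q m) (R_orbit_closure m n)"
proof
  let ?Z = "R_orbit_closure m n"
  define A where "A = coordinate_ring (Q m) ?Z"
  assume "normal_variety (Q m) ?Z"
  then have closed: "integrally_closed_domain A" by (simp add: A_def normal_variety_def)
  then interpret A: domain A by (simp add: integrally_closed_domain_def)
  have carrier: "carrier A = zero_ext ?Z ` poly_funs (Q m)"
    and mult: "f \<otimes>\<^bsub>A\<^esub> g = (\<lambda>x. f x * g x)" and add: "f \<oplus>\<^bsub>A\<^esub> g = (\<lambda>x. f x + g x)"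
    and zero: "\<zero>\<^bsub>A\<^esub> = (\<lambda>_. 0)" for f g
    by (simp_all add: A_def coordinate_ring_def)
  \<comment> \<open>Regular functions on the closure are determined by their values on the orbit, so
    identities in \<open>A\<close> can be checked there.\<close>
  have eqI: "f = g" if fg: "f \<in> carrier A" "g \<in> carrier A" and eq: "\<And>x. x \<in> orbit \<Longrightarrow> f x = g x" for f g
  proof -
    obtain F G where F: "F \<in> poly_funs (Q m)" "f = zero_ext ?Z F"
      and G: "G \<in> poly_funs (Q m)" "g = zero_ext ?Z G"
      using fg unfolding carrier by blast
    have "F - G \<in> poly_funs (Q m)"
      using F G unfolding poly_funs_def by (intro fun_space.span_diff)
    moreover have "(F - G) x = 0" if "x \<in> orbit" for x
      using eq[OF that] subsetD[OF orbit_subset that] by (simp add: F G zero_ext_def)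
    ultimately have "\<forall>x\<in>?Z. (F - G) x = 0"
      unfolding R_orbit_closure_def zariski_closure_def orbit_def by blast
    then show ?thesis by (auto simp: F G zero_ext_def)
  qed
  obtain l where l: "\<And>i j. l i j \<in> dual (Q m)"
    and on_orbit: "\<And>f. f \<in> orbit \<Longrightarrow> \<exists>t a1 a2 \<phi>. \<forall>i\<le>2. \<forall>j\<le>2.
      l i j f = t ^ (m - n - i) * Polynomial.coeff ([:a1, a2:] ^ i * \<phi>) j"
    and on_pt: "\<And>k s a b i j. k \<noteq> 0 \<Longrightarrow> i \<le> 2 \<Longrightarrow> j \<le> 2 \<Longrightarrow>
      l i j (degen k s a b) = Polynomial.coeff ([:s, s * a:] ^ i * [:k, k * b:]) j"
    using coordinate_functionals by blast
  \<comment> \<open>In the notation of the overview, \<open>y 0 j\<close> is \<open>u_j\<close>,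
    \<open>y 1 0\<close> is \<open>v\<close>, \<open>y 1 1\<close> is \<open>s\<close>,
    \<open>y 2 0\<close> is \<open>v'\<close> and \<open>y 2 2\<close> is \<open>w\<close>. The sign
    of \<open>w\<close> is absorbed into \<open>neg_y22\<close>, so that only sums and products
    occur.\<close>
  define y where "y i j = zero_ext ?Z (l i j)" for i j
  define neg_y22 where "neg_y22 = zero_ext ?Z (\<lambda>f. - 1 * l 2 2 f)"
  have y: "y i j \<in> carrier A" for i j
    unfolding y_def carrier using l dual_subset_poly_funs by blast
  have neg_y22: "neg_y22 \<in> carrier A"
    unfolding neg_y22_def carrier using scale_in_dual[OF l, of "- 1" 2 2] dual_subset_poly_funs by blast
  \<comment> \<open>\<open>?a / ?b\<close> is \<open>h = v * u_1 / u_0\<close>, and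
    \<open>?c\<close> is \<open>s ^ 2 - w * u_0 + v' * u_2\<close>, the claimed value of
    \<open>h ^ 2\<close>.\<close>
  let ?a = "y 1 0 \<otimes>\<^bsub>A\<^esub> y 0 1" and ?b = "y 0 0"
    and ?c = "y 1 1 \<otimes>\<^bsub>A\<^esub> y 1 1 \<oplus>\<^bsub>A\<^esub> (neg_y22 \<otimes>\<^bsub>A\<^esub> y 0 0 \<oplus>\<^bsub>A\<^esub> y 2 0 \<otimes>\<^bsub>A\<^esub> y 0 2)"
  have "?a \<otimes>\<^bsub>A\<^esub> ?a = ?c \<otimes>\<^bsub>A\<^esub> (?b \<otimes>\<^bsub>A\<^esub> ?b)"
  proof (rule eqI)
    fix f assume f: "f \<in> orbit"
    then obtain t a1 a2 \<phi> where
      lf: "\<forall>i\<le>2. \<forall>j\<le>2. l i j f = t ^ (m - n - i) * Polynomial.coeff ([:a1, a2:] ^ i * \<phi>) j"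
      using on_orbit by blast
    define f0 f1 f2 where "f0 = Polynomial.coeff \<phi> 0" "f1 = Polynomial.coeff \<phi> 1"
      "f2 = Polynomial.coeff \<phi> 2"
    define \<tau> where "\<tau> = t ^ (m - Suc (Suc n))"
    have "m - n = Suc (Suc (m - Suc (Suc n)))" "m - Suc n = Suc (m - Suc (Suc n))" using n m by auto
    then have \<tau>: "t ^ (m - n) = t * (t * \<tau>)" "t ^ (m - Suc n) = t * \<tau>"
      unfolding \<tau>_def by (metis power_Suc)+
    have "l 0 0 f = t * (t * \<tau>) * f0" "l 0 1 f = t * (t * \<tau>) * f1" "l 0 2 f = t * (t * \<tau>) * f2"
      "l 1 0 f = t * \<tau> * (a1 * f0)" "l 1 1 f = t * \<tau> * (a1 * f1 + a2 * f0)"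
      "l 2 0 f = \<tau> * (a1 * a1 * f0)"
      "l 2 2 f = \<tau> * (a1 * a1 * f2 + 2 * a1 * a2 * f1 + a2 * a2 * f0)"
      using lf by (simp_all add: \<tau> \<tau>_def[symmetric] f0_f1_f2_def coeff_mult power2_eq_square
          numeral_2_eq_2 algebra_simps)
    then show "(?a \<otimes>\<^bsub>A\<^esub> ?a) f = (?c \<otimes>\<^bsub>A\<^esub> (?b \<otimes>\<^bsub>A\<^esub> ?b)) f"
      using f orbit_subset
      by (auto simp: mult add y_def neg_y22_def zero_ext_def algebra_simps)
  qed (use y neg_y22 in \<open>simp_all\<close>)
  \<comment> \<open>The witness \<open>degen 1 0 0 0\<close> is \<open>x ^ (m - n) * y ^ n\<close>,
    where \<open>u_0\<close> is 1.\<close>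
  moreover have "?b \<noteq> \<zero>\<^bsub>A\<^esub>"
  proof
    assume "?b = \<zero>\<^bsub>A\<^esub>"
    then have "?b (degen 1 0 0 0) = 0" by (simp add: zero)
    then show False using on_pt[of 1 0 0 0 0 0] degen_in_closure[of 1] by (simp add: y_def zero_ext_def)
  qed
  ultimately obtain r where "r \<in> carrier A" and r: "?a = r \<otimes>\<^bsub>A\<^esub> ?b"
    using A.integrally_closed_sqrt[OF closed, of ?a ?b ?c] y neg_y22 by auto
  then obtain F where F: "F \<in> poly_funs (Q m)" "r = zero_ext ?Z F" unfolding carrier by blast
  \<comment> \<open>At this point \<open>v = s * k\<close>, \<open>u_1 = k * b\<close> and
    \<open>u_0 = k\<close>; dividing by \<open>u_0\<close> needs
    \<open>k \<noteq> 0\<close>.\<close>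
  have F_pt: "F (degen k s a b) = k * (s * b)" if k: "k \<noteq> 0" for k s a b
  proof -
    have "?a (degen k s a b) = (r \<otimes>\<^bsub>A\<^esub> ?b) (degen k s a b)" using r by simp
    then have "(s * k) * (k * b) = F (degen k s a b) * k"
      using degen_in_closure[OF k] k by (simp add: mult F y_def zero_ext_def on_pt)
    then show ?thesis using k by (simp add: mult.left_commute)
  qed
  have sub: "fun_space.subspace (Q m)" by (simp add: Q_def subspace_sym_power_dual)
  obtain L where L: "L \<in> dual (Q m)"
    and dL: "\<And>w. w \<in> Q m \<Longrightarrow> ((\<lambda>c. F (fscale c w)) has_field_derivative L w) (at 0)"
    using poly_fun_linear_part[OF sub F(1)] by blast
  \<comment> \<open>\<open>F\<close> is linear in \<open>k\<close> along the line through
    \<open>degen 1 s a b\<close>, hence equal there to its linear part. The value at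
    \<open>k = 0\<close>, excluded in \<open>F_pt\<close>, follows by continuity.\<close>
  have L_pt: "L (degen 1 s a b) = s * b" for s a b
  proof -
    have "degen 1 s a b \<in> Q m"
      using degen_in_closure[of 1] by (simp add: R_orbit_closure_def zariski_closure_def)
    from dL[OF this] have d: "((\<lambda>k. F (degen k s a b)) has_field_derivative L (degen 1 s a b)) (at 0)"
      by (simp add: degen_scale[of _ s a b, symmetric])
    then have "(\<lambda>k. F (degen k s a b)) \<midarrow>0\<rightarrow> F (degen 0 s a b)"
      using DERIV_isCont isCont_def by blast
    moreover have "(\<lambda>k. F (degen k s a b)) \<midarrow>0\<rightarrow> 0"
      by (rule LIM_equal2[of 1 _ _ "\<lambda>k. k * (s * b)"])
        (auto simp: F_pt intro!: tendsto_eq_intros)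
    ultimately have "F (degen 0 s a b) = 0" by (rule LIM_unique)
    then have "F (degen k s a b) = k * (s * b)" for k by (cases "k = 0") (simp_all add: F_pt)
    then have "((\<lambda>k. k * (s * b)) has_field_derivative L (degen 1 s a b)) (at 0)" using d by simp
    moreover have "((\<lambda>k. k * (s * b)) has_field_derivative s * b) (at 0)"
      by (auto intro!: derivative_eq_intros)
    ultimately show ?thesis by (rule DERIV_unique)
  qed
  \<comment> \<open>The tangent vectors from \<open>degen_tangent\<close>. Differentiating
    \<open>L_pt\<close> in \<open>s\<close> gives \<open>L (W a b) = b\<close>, which contradicts
    the symmetry of \<open>W\<close> in \<open>a\<close> and \<open>b\<close>.\<close>
  define W where "W a b = zero_ext (E m) (\<lambda>M. of_nat (m - n) * M (1, 1) ^ (m - n - 1) * (M p + a * M q)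
       * (M p ^ (n - 1) * (M p + b * M q)))" for a b
  have "L (W a b) = b" for a b
  proof -
    have "((\<lambda>s. L (degen 1 s a b)) has_field_derivative L (W a b)) (at 0)"
      using degen_tangent[of a b] L unfolding W_def by blast
    then have "((\<lambda>s. s * b) has_field_derivative L (W a b)) (at 0)" by (simp add: L_pt)
    moreover have "((\<lambda>s. s * b) has_field_derivative b) (at 0)"
      by (auto intro!: derivative_eq_intros)
    ultimately show ?thesis by (rule DERIV_unique)
  qed
  moreover have "W 1 0 = W 0 1" by (simp add: W_def mult_ac)
  ultimately show False by (metis zero_neq_one)
qed

end

theorem corollary8p2:
  fixes m n :: nat
  assumes "n \<ge> 3" and "m \<ge> 2 * n"
  shows "\<not> normal_variety (Q m) (R_orbit_closure m n)"
proof -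
  interpret padded m n using assms by unfold_locales auto
  show ?thesis by (rule not_normal)
qed

end
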